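(* Let $\mathcal A$ be a $\mathcal B(\mathcal H,\mathcal K)$-valued frame sequence with lower frame bound $\alpha$ and let $\mathcal B$ be a $\mathcal B(\mathcal H,\mathcal K)$-valued $\mu$-perturbation of $\mathcal A$, $0<\mu<\sqrt{\alpha}$, such that $\Delta:=\Delta(\mathcal H_{\mathcal A},\mathcal H_{\mathcal B})<1$. Then $\mathcal B$ is an operator-valued frame sequence, and for every $L\in\mathcal L_{\mathcal A}$ the dual $$\widetilde{\mathcal B}_L:=\widetilde{\mathcal B}\left(P_{\ker T_{\mathcal B}^*}T_{\widetilde{\mathcal A}(L)}|\mathcal H_{\mathcal B}\right)$$ of $\mathcal B$ is a $\lambda$-perturbation of $\widetilde{\mathcal A}(L)$, where $$\lambda=\frac{\mu+(2\sqrt{\alpha}-\mu)\Delta}{\sqrt{\alpha}\,(\sqrt{\alpha}-\mu)}+\left(\frac{\mu}{\sqrt{\alpha}-\mu}+\Delta\right)\|L\|.$$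
   Context: $\mathcal H,\mathcal K$ are Hilbert spaces, $I\subset\mathbb N$ is a finite or countable index set, and $\mathfrak K:=\ell^2(I,\mathcal K)$ is the Hilbert space of square-summable $\mathcal K$-valued sequences. $\mathcal B(X,Y)$ denotes the bounded everywhere defined linear operators $X\to Y$, with the operator norm; $P_V$ is the orthogonal projection onto a closed subspace $V$. A sequence $\mathcal A=(A_i)_{i\in I}\subset\mathcal B(\mathcal H,\mathcal K)$ is a $\mathcal B(\mathcal H,\mathcal K)$-valued Bessel sequence if there is $\beta>0$ with $\sum_{i\in I}\|A_ix\|^2\le\beta\|x\|^2$ for all $x\in\mathcal H$. Put $\mathcal H_{\mathcal A}:=\overline{\operatorname{span}}\{\operatorname{ran}A_i^*: i\in I\}$ and $P_{\mathcal A}:=P_{\mathcal H_{\mathcal A}}$. The analysis operator is $T_{\mathcal A}\in\mathcal B(\mathcal H,\mathfrak K)$, $T_{\mathcal A}x=(A_ix)_{i\in I}$, and the frame operator is $S_{\mathcal A}:=T_{\mathcal A}^*T_{\mathcal A}$. The map $\mathcal A\mapsto T_{\mathcal A}$ is a bijection from Bessel sequences onto $\mathcal B(\mathcal H,\mathfrak K)$. $\mathcal A$ is a $\mathcal B(\mathcal H,\mathcal K)$-valued frame sequence with lower and upper frame bounds $\alpha,\beta>0$ if $\alpha\|x\|^2\le\sum_{i\in I}\|A_ix\|^2\le\beta\|x\|^2$ for all $x\in\mathcal H_{\mathcal A}$; then $S_{\mathcal A}|\mathcal H_{\mathcal A}$ is boundedly invertible on $\mathcal H_{\mathcal A}$.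 A dual of an operator-valued frame sequence $\mathcal A$ is a $\mathcal B(\mathcal H,\mathcal K)$-valued Bessel sequence $\widetilde{\mathcal A}=(\widetilde A_i)_{i\in I}$ with $\mathcal H_{\widetilde{\mathcal A}}\subset\mathcal H_{\mathcal A}$ and $\sum_{i\in I}\widetilde A_i^*A_ix=x$ for all $x\in\mathcal H_{\mathcal A}$. Put $\mathcal L_{\mathcal A}:=\{L\in\mathcal B(\mathcal H_{\mathcal A},\mathfrak K): T_{\mathcal A}^*L=0\}$. For $L\in\mathcal L_{\mathcal A}$, $\widetilde{\mathcal A}(L)$ denotes the dual of $\mathcal A$ with analysis operator $T_{\widetilde{\mathcal A}(L)}=(T_{\mathcal A}(S_{\mathcal A}|\mathcal H_{\mathcal A})^{-1}+L)P_{\mathcal A}$; $L\mapsto\widetilde{\mathcal A}(L)$ is a bijection from $\mathcal L_{\mathcal A}$ onto the set of duals of $\mathcal A$. The same notation is used for $\mathcal B$. For $\mu>0$, a $\mathcal B(\mathcal H,\mathcal K)$-valued Bessel sequence $\mathcal B$ is a $\mu$-perturbation of the $\mathcal B(\mathcal H,\mathcal K)$-valued Bessel sequence $\mathcal A$ if $\|T_{\mathcal A}-T_{\mathcal B}\|\le\mu$. For closed subspaces $V,W$ of $\mathcal H$, $\delta(V,W):=\|(I-P_W)|V\|$ and the gap between $V$ and $W$ is $\Delta(V,W):=\max\{\delta(V,W),\delta(W,V)\}$, which equals $\|P_V-P_W\|$. *)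

theory Defs
  imports "HOL-Analysis.Analysis"
begin

text \<open>
  Hilbert spaces over the real and over the complex numbers are treated uniformly. The
  only fields of the following kind are \<open>\<real>\<close> with the identity and \<open>\<complex>\<close> with complex
  conjugation: \<open>x + sconj x\<close> is real, as one sees by expanding \<open>(1 + x) * sconj (1 + x)\<close>, so
  every \<open>x\<close> is a root of a real quadratic polynomial.
\<close>

class rc_field = real_normed_field + banach +
  fixes sconj :: "'a \<Rightarrow> 'a"
  assumes sconj_add: "sconj (x + y) = sconj x + sconj y"
    and mult_sconj: "x * sconj x = (norm x)\<^sup>2 *\<^sub>R 1"

instantiation real :: rc_field
begin
definition sconj_real :: "real \<Rightarrow> real" where "sconj_real x = x"
instance by standard (simp_all add: sconj_real_def power2_eq_square)
end

instantiation complex :: rc_field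
begin
definition sconj_complex :: "complex \<Rightarrow> complex" where "sconj_complex = cnj"
instance
proof
  fix x y :: complex
  show "sconj (x + y) = sconj x + sconj y" by (simp add: sconj_complex_def)
  show "x * sconj x = (norm x)\<^sup>2 *\<^sub>R 1"
    by (simp add: sconj_complex_def complex_norm_square[symmetric] scaleR_conv_of_real)
qed
end

lemma sconj_0 [simp]: "sconj (0::'a::rc_field) = 0"
  using sconj_add[of "0::'a" 0] by simp

lemma sconj_of_real: "sconj (of_real r :: 'a::rc_field) = of_real r"
proof (cases "r = 0")
  case False
  have "of_real r * sconj (of_real r :: 'a) = of_real r * of_real r"
    unfolding mult_sconj by (simp add: scaleR_conv_of_real power2_eq_square)
  then show ?thesis using False by simp
qed simp

lemma sconj_mult: "sconj (x * y) = sconj x * sconj (y::'a::rc_field)"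
proof (cases "x = 0 \<or> y = 0")
  case False
  have "(x * y) * sconj (x * y) = (x * sconj x) * (y * sconj y)"
    unfolding mult_sconj by (simp add: norm_mult power_mult_distrib scaleR_conv_of_real)
  then have "(x * y) * sconj (x * y) = (x * y) * (sconj x * sconj y)" by (simp add: ac_simps)
  then show ?thesis using False by (metis mult_left_cancel mult_eq_0_iff)
qed auto

record ('s, 'a) hspace =
  smult :: "'s \<Rightarrow> 'a \<Rightarrow> 'a"
  ip :: "'a \<Rightarrow> 'a \<Rightarrow> 's"

text \<open>
  The carrier type provides addition, multiplication by real scalars, the norm and completeness.
  Since the norm determines the inner product of the class \<^class>\<open>real_inner\<close>, the last
  axiom makes the latter the real part of \<open>ip H\<close>.
\<close>

locale hilbert_space =
  fixes H :: "('s::rc_field, 'a::{real_inner,complete_space}) hspace"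
  assumes vector_space_smult: "vector_space (smult H)"
    and smult_of_real: "smult H (of_real r) x = r *\<^sub>R x"
    and ip_add_left: "ip H (x + y) z = ip H x z + ip H y z"
    and ip_smult_left: "ip H (smult H c x) y = c * ip H x y"
    and ip_commute: "ip H y x = sconj (ip H x y)"
    and ip_self: "ip H x x = of_real ((norm x)\<^sup>2)"

typedef (overloaded) 'b ell2 =
  "{f :: nat \<Rightarrow> 'b::real_inner. (\<lambda>i. (norm (f i))\<^sup>2) summable_on UNIV}"
  morphisms ell2_nth Abs_ell2
  by (rule exI[of _ "\<lambda>_. 0"]) simp

setup_lifting type_definition_ell2

lemma ell2_summable_add:
  fixes f g :: "nat \<Rightarrow> 'b::real_inner"
  assumes "(\<lambda>i. (norm (f i))\<^sup>2) summable_on UNIV" "(\<lambda>i. (norm (g i))\<^sup>2) summable_on UNIV"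
  shows "(\<lambda>i. (norm (f i + g i))\<^sup>2) summable_on UNIV"
proof (rule summable_on_comparison_test)
  show "(\<lambda>i. 2 * (norm (f i))\<^sup>2 + 2 * (norm (g i))\<^sup>2) summable_on UNIV"
    by (intro summable_on_add summable_on_cmult_right assms)
  fix i
  have "(norm (f i + g i))\<^sup>2 \<le> (norm (f i) + norm (g i))\<^sup>2"
    by (intro power_mono norm_triangle_ineq) auto
  also have "\<dots> \<le> 2 * (norm (f i))\<^sup>2 + 2 * (norm (g i))\<^sup>2"
    using sum_squares_bound[of "norm (f i)" "norm (g i)"] by (simp add: power2_sum)
  finally show "(norm (f i + g i))\<^sup>2 \<le> 2 * (norm (f i))\<^sup>2 + 2 * (norm (g i))\<^sup>2" .
qed auto

lemma ell2_nth_summable: "(\<lambda>i. (norm (ell2_nth f i))\<^sup>2) summable_on UNIV"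
  using ell2_nth by blast

lemma ell2_abs_summable_mult:
  fixes f g :: "'b::real_inner ell2"
  shows "(\<lambda>i. norm (ell2_nth f i) * norm (ell2_nth g i)) summable_on UNIV"
proof (rule summable_on_comparison_test)
  show "(\<lambda>i. (norm (ell2_nth f i))\<^sup>2 + (norm (ell2_nth g i))\<^sup>2) summable_on UNIV"
    by (intro summable_on_add ell2_nth_summable)
  fix i
  have "2 * (norm (ell2_nth f i) * norm (ell2_nth g i))
      \<le> (norm (ell2_nth f i))\<^sup>2 + (norm (ell2_nth g i))\<^sup>2"
    using sum_squares_bound[of "norm (ell2_nth f i)" "norm (ell2_nth g i)"]
    by (simp add: mult.assoc)
  then show "norm (ell2_nth f i) * norm (ell2_nth g i)
      \<le> (norm (ell2_nth f i))\<^sup>2 + (norm (ell2_nth g i))\<^sup>2"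
    using mult_nonneg_nonneg[OF norm_ge_zero[of "ell2_nth f i"] norm_ge_zero[of "ell2_nth g i"]]
    by linarith
qed auto

lemma ell2_inner_summable:
  fixes f g :: "'b::real_inner ell2"
  shows "(\<lambda>i. inner (ell2_nth f i) (ell2_nth g i)) summable_on UNIV"
proof -
  have "(\<lambda>i. norm (inner (ell2_nth f i) (ell2_nth g i))) summable_on UNIV"
    by (rule summable_on_comparison_test[OF ell2_abs_summable_mult[of f g]])
       (auto simp: Cauchy_Schwarz_ineq2)
  then show ?thesis by (rule abs_summable_summable)
qed

instantiation ell2 :: (real_inner) real_inner
begin

lift_definition zero_ell2 :: "'a ell2" is "\<lambda>_. 0" by simp
lift_definition plus_ell2 :: "'a ell2 \<Rightarrow> 'a ell2 \<Rightarrow> 'a ell2" is "\<lambda>f g i. f i + g i"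
  by (rule ell2_summable_add)
lift_definition uminus_ell2 :: "'a ell2 \<Rightarrow> 'a ell2" is "\<lambda>f i. - f i" by simp
lift_definition minus_ell2 :: "'a ell2 \<Rightarrow> 'a ell2 \<Rightarrow> 'a ell2" is "\<lambda>f g i. f i - g i"
  using ell2_summable_add[of _ "\<lambda>i. - _ i"] by simp
lift_definition scaleR_ell2 :: "real \<Rightarrow> 'a ell2 \<Rightarrow> 'a ell2" is "\<lambda>r f i. r *\<^sub>R f i"
  by (simp add: power_mult_distrib summable_on_cmult_right)

definition inner_ell2 :: "'a ell2 \<Rightarrow> 'a ell2 \<Rightarrow> real" where
  "inner_ell2 f g = (\<Sum>\<^sub>\<infinity>i. inner (ell2_nth f i) (ell2_nth g i))"
definition norm_ell2 :: "'a ell2 \<Rightarrow> real" where "norm_ell2 f = sqrt (inner f f)"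
definition sgn_ell2 :: "'a ell2 \<Rightarrow> 'a ell2" where "sgn_ell2 f = inverse (norm f) *\<^sub>R f"
definition dist_ell2 :: "'a ell2 \<Rightarrow> 'a ell2 \<Rightarrow> real" where "dist_ell2 f g = norm (f - g)"
definition uniformity_ell2 :: "('a ell2 \<times> 'a ell2) filter" where
  "uniformity_ell2 = (INF e\<in>{0<..}. principal {(x, y). dist x y < e})"
definition open_ell2 :: "'a ell2 set \<Rightarrow> bool" where
  "open_ell2 U \<longleftrightarrow> (\<forall>x\<in>U. \<forall>\<^sub>F (x', y) in uniformity. x' = x \<longrightarrow> y \<in> U)"

instance
proof
  fix f g h :: "'a ell2" and r s :: real
  show "f + g + h = f + (g + h)" by transfer (simp add: add.assoc)
  show "f + g = g + f" by transfer (simp add: add.commute)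
  show "0 + f = f" by transfer simp
  show "- f + f = 0" by transfer simp
  show "f - g = f + - g" by transfer simp
  show "r *\<^sub>R (f + g) = r *\<^sub>R f + r *\<^sub>R g" by transfer (simp add: scaleR_add_right)
  show "(r + s) *\<^sub>R f = r *\<^sub>R f + s *\<^sub>R f" by transfer (simp add: scaleR_add_left)
  show "r *\<^sub>R s *\<^sub>R f = (r * s) *\<^sub>R f" by transfer simp
  show "1 *\<^sub>R f = f" by transfer simp
  show "inner f g = inner g f" by (simp add: inner_ell2_def inner_commute)
  show "inner (f + g) h = inner f h + inner g h"
    unfolding inner_ell2_def plus_ell2.rep_eq inner_add_left
    by (intro infsum_add ell2_inner_summable)
  show "inner (r *\<^sub>R f) g = r * inner f g"
    unfolding inner_ell2_def scaleR_ell2.rep_eq inner_scaleR_left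
    by (intro infsum_cmult_right ell2_inner_summable)
  show "0 \<le> inner f f" unfolding inner_ell2_def by (intro infsum_nonneg) simp
  show "inner f f = 0 \<longleftrightarrow> f = 0"
  proof
    assume "inner f f = 0"
    then have "inner (ell2_nth f i) (ell2_nth f i) = 0" for i
      unfolding inner_ell2_def
      by (intro nonneg_infsum_le_0D[where A=UNIV]) (auto intro: ell2_inner_summable)
    then show "f = 0" by (simp add: ell2_nth_inject[symmetric] zero_ell2.rep_eq fun_eq_iff)
  qed (simp add: inner_ell2_def zero_ell2.rep_eq)
qed (simp_all add: norm_ell2_def sgn_ell2_def dist_ell2_def uniformity_ell2_def open_ell2_def)

end

lemma norm_ell2_power2: "(norm f)\<^sup>2 = (\<Sum>\<^sub>\<infinity>i. (norm (ell2_nth f i))\<^sup>2)"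
  by (simp add: power2_norm_eq_inner inner_ell2_def)

lemma norm_ell2_nth_le: "norm (ell2_nth f i) \<le> norm f"
proof -
  have "(\<Sum>j\<in>{i}. (norm (ell2_nth f j))\<^sup>2) \<le> (norm f)\<^sup>2"
    unfolding norm_ell2_power2 by (intro finite_sum_le_infsum ell2_nth_summable) auto
  then show ?thesis by (simp add: power2_le_iff_abs_le)
qed

instance ell2 :: ("{real_inner,complete_space}") complete_space
proof
  fix X :: "nat \<Rightarrow> 'a ell2"
  assume X: "Cauchy X"
  have "Cauchy (\<lambda>n. ell2_nth (X n) i)" for i
  proof (rule CauchyI)
    fix e :: real
    assume "e > 0"
    then obtain M where M: "\<And>m n. m \<ge> M \<Longrightarrow> n \<ge> M \<Longrightarrow> norm (X m - X n) < e"
      using CauchyD[OF X] by blast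
    have "norm (ell2_nth (X m) i - ell2_nth (X n) i) < e" if "m \<ge> M" "n \<ge> M" for m n
      using norm_ell2_nth_le[of "X m - X n" i] M[OF that] by (simp add: minus_ell2.rep_eq)
    then show "\<exists>M. \<forall>m\<ge>M. \<forall>n\<ge>M. norm (ell2_nth (X m) i - ell2_nth (X n) i) < e" by blast
  qed
  then have "\<exists>l. (\<lambda>n. ell2_nth (X n) i) \<longlonglongrightarrow> l" for i
    using Cauchy_convergent convergent_def by blast
  then obtain l where l: "\<And>i. (\<lambda>n. ell2_nth (X n) i) \<longlonglongrightarrow> l i" by metis
  have part: "\<exists>M. \<forall>n\<ge>M. \<forall>F. finite F \<longrightarrow> (\<Sum>i\<in>F. (norm (ell2_nth (X n) i - l i))\<^sup>2) \<le> e\<^sup>2"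
    if e: "e > 0" for e
  proof -
    obtain M where M: "\<And>m n. m \<ge> M \<Longrightarrow> n \<ge> M \<Longrightarrow> norm (X m - X n) < e"
      using CauchyD[OF X e] by blast
    have "(\<Sum>i\<in>F. (norm (ell2_nth (X n) i - l i))\<^sup>2) \<le> e\<^sup>2" if "n \<ge> M" "finite F" for n F
    proof (rule tendsto_upperbound)
      show "(\<lambda>m. \<Sum>i\<in>F. (norm (ell2_nth (X n) i - ell2_nth (X m) i))\<^sup>2)
          \<longlonglongrightarrow> (\<Sum>i\<in>F. (norm (ell2_nth (X n) i - l i))\<^sup>2)"
        by (intro tendsto_intros l)
      show "\<forall>\<^sub>F m in sequentially. (\<Sum>i\<in>F. (norm (ell2_nth (X n) i - ell2_nth (X m) i))\<^sup>2) \<le> e\<^sup>2"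
        using eventually_ge_at_top[of M]
      proof eventually_elim
        case (elim m)
        have "(\<Sum>i\<in>F. (norm (ell2_nth (X n - X m) i))\<^sup>2) \<le> (norm (X n - X m))\<^sup>2"
          unfolding norm_ell2_power2
          by (intro finite_sum_le_infsum ell2_nth_summable \<open>finite F\<close>) auto
        also have "\<dots> \<le> e\<^sup>2"
          using M[OF \<open>n \<ge> M\<close> elim] by (intro power_mono) auto
        finally show ?case by (simp add: minus_ell2.rep_eq)
      qed
    qed auto
    then show ?thesis by blast
  qed
  have summ: "(\<lambda>i. (norm (g i))\<^sup>2) summable_on UNIV"
    if "\<And>F. finite F \<Longrightarrow> (\<Sum>i\<in>F. (norm (g i))\<^sup>2) \<le> c" for g :: "nat \<Rightarrow> 'a" and c
    by (rule nonneg_bdd_above_summable_on) (auto intro!: bdd_aboveI[of _ c] that)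
  obtain M where "\<And>F. finite F \<Longrightarrow> (\<Sum>i\<in>F. (norm (ell2_nth (X M) i - l i))\<^sup>2) \<le> 1\<^sup>2"
    using part[of 1] by auto
  then have "(\<lambda>i. (norm (ell2_nth (X M) i - l i))\<^sup>2) summable_on UNIV" by (rule summ)
  then have "(\<lambda>i. (norm (- (ell2_nth (X M) i - l i) + ell2_nth (X M) i))\<^sup>2) summable_on UNIV"
    by (intro ell2_summable_add ell2_nth_summable) (simp add: norm_minus_commute)
  then have l2: "(\<lambda>i. (norm (l i))\<^sup>2) summable_on UNIV" by simp
  define Y where "Y = Abs_ell2 l"
  have Y: "ell2_nth Y = l" using l2 by (simp add: Y_def Abs_ell2_inverse)
  have "X \<longlonglongrightarrow> Y"
  proof (rule LIMSEQ_I)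
    fix e :: real
    assume "e > 0"
    then obtain M where M: "\<And>n F. n \<ge> M \<Longrightarrow> finite F \<Longrightarrow>
        (\<Sum>i\<in>F. (norm (ell2_nth (X n) i - l i))\<^sup>2) \<le> (e/2)\<^sup>2"
      using part[of "e/2"] by auto
    have "norm (X n - Y) < e" if "n \<ge> M" for n
    proof -
      have "(norm (X n - Y))\<^sup>2 \<le> (e/2)\<^sup>2"
        unfolding norm_ell2_power2
        by (rule infsum_le_finite_sums[OF ell2_nth_summable])
           (use M[OF that] in \<open>simp add: minus_ell2.rep_eq Y\<close>)
      then show ?thesis using \<open>e > 0\<close> by (simp add: power2_le_iff_abs_le)
    qed
    then show "\<exists>M. \<forall>n\<ge>M. norm (X n - Y) < e" by blast
  qed
  then show "convergent X" by (auto simp: convergent_def)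
qed

definition ell2_space :: "('s::rc_field, 'b::real_inner) hspace \<Rightarrow> ('s, 'b ell2) hspace" where
  "ell2_space K = \<lparr>smult = (\<lambda>c f. Abs_ell2 (\<lambda>i. smult K c (ell2_nth f i))),
                   ip = (\<lambda>f g. \<Sum>\<^sub>\<infinity>i. ip K (ell2_nth f i) (ell2_nth g i))\<rparr>"

context hilbert_space
begin

lemma ip_add_right: "ip H x (y + z) = ip H x y + ip H x z"
  by (metis ip_add_left ip_commute sconj_add)

lemma ip_smult_right: "ip H x (smult H c y) = sconj c * ip H x y"
  by (metis ip_smult_left ip_commute sconj_mult)

lemma norm_smult: "norm (smult H c x) = norm c * norm x"
proof -
  have "(of_real ((norm (smult H c x))\<^sup>2) :: 's) = (c * sconj c) * ip H x x"
    unfolding ip_self[symmetric] ip_smult_left ip_smult_right by (simp only: ac_simps)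
  also have "\<dots> = of_real ((norm c * norm x)\<^sup>2)"
    unfolding mult_sconj ip_self by (simp add: scaleR_conv_of_real power_mult_distrib)
  finally have "(norm (smult H c x))\<^sup>2 = (norm c * norm x)\<^sup>2" by (simp only: of_real_eq_iff)
  then show ?thesis by (simp add: power2_eq_iff_nonneg)
qed

lemma ip_cauchy_schwarz: "norm (ip H x y) \<le> norm x * norm y"
proof (cases "y = 0")
  case True
  have "ip H x (0 + 0) = ip H x 0 + ip H x 0" by (rule ip_add_right)
  then show ?thesis using True by simp
next
  case False
  define a where "a = ip H x y"
  define n where "n = (of_real ((norm y)\<^sup>2) :: 's)"
  define z where "z = smult H n x + smult H (- a) y"
  have n: "sconj n = n" unfolding n_def by (rule sconj_of_real)
  have neg: "sconj (- a) = - sconj a"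
    using sconj_add[of a "- a"] by (simp add: eq_neg_iff_add_eq_0 add.commute)
  have yy: "ip H y y = n" unfolding n_def by (rule ip_self)
  have yx: "ip H y x = sconj a" by (simp add: a_def ip_commute[of y x])
  have "(of_real ((norm z)\<^sup>2) :: 's)
      = n * (n * ip H x x) - n * (sconj a * a) + (- a * (n * sconj a)) + a * (sconj a * n)"
    unfolding ip_self[symmetric] z_def
    by (simp add: ip_add_left ip_add_right ip_smult_left ip_smult_right n neg yx
        a_def[symmetric] yy algebra_simps)
  also have "\<dots> = n * (n * ip H x x - a * sconj a)" by (simp add: algebra_simps)
  also have "\<dots> = of_real ((norm y)\<^sup>2 * ((norm x * norm y)\<^sup>2 - (norm a)\<^sup>2))"
    unfolding ip_self mult_sconj n_def
    by (simp add: scaleR_conv_of_real power_mult_distrib mult.commute)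
  finally have "(norm z)\<^sup>2 = (norm y)\<^sup>2 * ((norm x * norm y)\<^sup>2 - (norm a)\<^sup>2)"
    by (simp only: of_real_eq_iff)
  then have "0 \<le> (norm y)\<^sup>2 * ((norm x * norm y)\<^sup>2 - (norm a)\<^sup>2)"
    by (metis zero_le_power2)
  then have "(norm a)\<^sup>2 \<le> (norm x * norm y)\<^sup>2"
    using False by (simp add: zero_le_mult_iff)
  then show ?thesis unfolding a_def by (rule power2_le_imp_le) simp
qed

lemma ell2_smult_nth:
  "ell2_nth (smult (ell2_space H) c f) i = smult H c (ell2_nth f i)"
proof -
  have "(\<lambda>i. (norm (smult H c (ell2_nth f i)))\<^sup>2) summable_on UNIV"
    by (simp add: norm_smult power_mult_distrib summable_on_cmult_right ell2_nth_summable)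
  then show ?thesis by (simp add: ell2_space_def Abs_ell2_inverse)
qed

end

lemma hilbert_space_ell2:
  assumes "hilbert_space K"
  shows "hilbert_space (ell2_space K)"
proof -
  interpret K: hilbert_space K by (rule assms)
  interpret V: vector_space "smult K" by (rule K.vector_space_smult)
  note eq = ell2_nth_inject[symmetric] fun_eq_iff K.ell2_smult_nth plus_ell2.rep_eq
    scaleR_ell2.rep_eq
  have ip: "ip (ell2_space K) f g = (\<Sum>\<^sub>\<infinity>i. ip K (ell2_nth f i) (ell2_nth g i))" for f g
    by (simp add: ell2_space_def)
  have summ: "(\<lambda>i. ip K (ell2_nth f i) (ell2_nth g i)) summable_on UNIV" for f g
  proof -
    have "(\<lambda>i. norm (ip K (ell2_nth f i) (ell2_nth g i))) summable_on UNIV"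
      by (rule summable_on_comparison_test[OF ell2_abs_summable_mult[of f g]])
         (auto simp: K.ip_cauchy_schwarz)
    then show ?thesis by (rule abs_summable_summable)
  qed
  have bl: "bounded_linear (sconj :: 'a \<Rightarrow> 'a)"
  proof (rule bounded_linear_intro)
    fix x y :: 'a and r :: real
    show "sconj (x + y) = sconj x + sconj y" by (rule sconj_add)
    show "sconj (r *\<^sub>R x) = r *\<^sub>R sconj x"
      by (simp add: scaleR_conv_of_real sconj_mult sconj_of_real)
    have "norm x * norm (sconj x) = norm x * norm x"
      using arg_cong[OF mult_sconj[of x], of norm] by (simp add: norm_mult power2_eq_square)
    then show "norm (sconj x) \<le> norm x * 1" by (cases "x = 0") auto
  qed
  show ?thesis
  proof
    fix f g h :: "'b ell2" and c d :: 'a and r :: real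
    let ?s = "smult (ell2_space K)"
    show "?s c (f + g) = ?s c f + ?s c g" by (simp add: eq V.scale_right_distrib)
    show "?s (c + d) f = ?s c f + ?s d f" by (simp add: eq V.scale_left_distrib)
    show "?s c (?s d f) = ?s (c * d) f" by (simp add: eq)
    show "?s 1 f = f" by (simp add: eq)
    show "?s (of_real r) f = r *\<^sub>R f" by (simp add: eq K.smult_of_real)
    show "ip (ell2_space K) (f + g) h = ip (ell2_space K) f h + ip (ell2_space K) g h"
      unfolding ip plus_ell2.rep_eq K.ip_add_left by (intro infsum_add summ)
    show "ip (ell2_space K) (?s c f) g = c * ip (ell2_space K) f g"
      unfolding ip K.ell2_smult_nth K.ip_smult_left by (intro infsum_cmult_right summ)
    show "ip (ell2_space K) g f = sconj (ip (ell2_space K) f g)"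
      unfolding ip K.ip_commute[of "ell2_nth g _"]
      by (intro infsumI has_sum_bounded_linear[OF bl] has_sum_infsum summ)
    show "ip (ell2_space K) f f = of_real ((norm f)\<^sup>2)"
      unfolding ip K.ip_self norm_ell2_power2
      by (intro infsumI has_sum_bounded_linear[OF bounded_linear_of_real] has_sum_infsum
          ell2_nth_summable)
  qed
qed

text \<open>\<open>\<ell>\<^sup>2(I, K)\<close>, as the subspace of \<open>\<ell>\<^sup>2(\<nat>, K)\<close> of sequences supported in \<open>I\<close>.\<close>

definition ell2_on :: "nat set \<Rightarrow> 'b::real_inner ell2 set" where
  "ell2_on I = {f. \<forall>i. i \<notin> I \<longrightarrow> ell2_nth f i = 0}"

text \<open>
  An operator on a subspace \<open>V\<close> is represented by a function on the whole type whose
  values outside \<open>V\<close> are irrelevant.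
\<close>

definition bounded_ops ::
  "('s::rc_field, 'a::real_inner) hspace \<Rightarrow> ('s, 'b::real_inner) hspace \<Rightarrow>
    'a set \<Rightarrow> 'b set \<Rightarrow> ('a \<Rightarrow> 'b) set" where
  "bounded_ops H K V W = {T.
     (\<forall>x\<in>V. T x \<in> W) \<and>
     (\<forall>x\<in>V. \<forall>y\<in>V. T (x + y) = T x + T y) \<and>
     (\<forall>c. \<forall>x\<in>V. T (smult H c x) = smult K c (T x)) \<and>
     (\<exists>C. \<forall>x\<in>V. norm (T x) \<le> C * norm x)}"

text \<open>The restriction of \<^const>\<open>onorm\<close> to a subspace; it is 0 for the zero space.\<close>

definition onorm_on :: "'a::real_normed_vector set \<Rightarrow> ('a \<Rightarrow> 'b::real_normed_vector) \<Rightarrow> real" where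
  "onorm_on V T = (SUP x\<in>V. norm (T x) / norm x)"

definition adj ::
  "('s, 'a) hspace \<Rightarrow> ('s, 'b) hspace \<Rightarrow> ('a \<Rightarrow> 'b) \<Rightarrow> 'b \<Rightarrow> 'a" where
  "adj H K T y = (THE z. \<forall>x. ip K (T x) y = ip H x z)"

definition proj :: "('s::zero, 'a::minus) hspace \<Rightarrow> 'a set \<Rightarrow> 'a \<Rightarrow> 'a" where
  "proj H V x = (THE p. p \<in> V \<and> (\<forall>v\<in>V. ip H (x - p) v = 0))"

definition directed_gap ::
  "('s::zero, 'a::real_normed_vector) hspace \<Rightarrow> 'a set \<Rightarrow> 'a set \<Rightarrow> real" where
  "directed_gap H V W = onorm_on V (\<lambda>x. x - proj H W x)"

definition gap ::
  "('s::zero, 'a::real_normed_vector) hspace \<Rightarrow> 'a set \<Rightarrow> 'a set \<Rightarrow> real" where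
  "gap H V W = max (directed_gap H V W) (directed_gap H W V)"

definition bessel ::
  "('s::rc_field, 'a::real_inner) hspace \<Rightarrow> ('s, 'b::real_inner) hspace \<Rightarrow> nat set \<Rightarrow>
    (nat \<Rightarrow> 'a \<Rightarrow> 'b) \<Rightarrow> bool" where
  "bessel H K I A \<longleftrightarrow>
     (\<forall>i\<in>I. A i \<in> bounded_ops H K UNIV UNIV) \<and>
     (\<exists>\<beta>>0. \<forall>x. (\<lambda>i. (norm (A i x))\<^sup>2) summable_on I \<and>
        (\<Sum>\<^sub>\<infinity>i\<in>I. (norm (A i x))\<^sup>2) \<le> \<beta> * (norm x)\<^sup>2)"

definition range_space ::
  "('s::rc_field, 'a::real_inner) hspace \<Rightarrow> ('s, 'b::real_inner) hspace \<Rightarrow> nat set \<Rightarrow>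
    (nat \<Rightarrow> 'a \<Rightarrow> 'b) \<Rightarrow> 'a set" where
  "range_space H K I A = closure (module.span (smult H) (\<Union>i\<in>I. range (adj H K (A i))))"

definition frame_sequence ::
  "('s::rc_field, 'a::real_inner) hspace \<Rightarrow> ('s, 'b::real_inner) hspace \<Rightarrow> nat set \<Rightarrow>
    (nat \<Rightarrow> 'a \<Rightarrow> 'b) \<Rightarrow> real \<Rightarrow> real \<Rightarrow> bool" where
  "frame_sequence H K I A \<alpha> \<beta> \<longleftrightarrow>
     (\<forall>i\<in>I. A i \<in> bounded_ops H K UNIV UNIV) \<and> 0 < \<alpha> \<and> 0 < \<beta> \<and>
     (\<forall>x\<in>range_space H K I A. (\<lambda>i. (norm (A i x))\<^sup>2) summable_on I \<and>
        \<alpha> * (norm x)\<^sup>2 \<le> (\<Sum>\<^sub>\<infinity>i\<in>I. (norm (A i x))\<^sup>2) \<and>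
        (\<Sum>\<^sub>\<infinity>i\<in>I. (norm (A i x))\<^sup>2) \<le> \<beta> * (norm x)\<^sup>2)"

definition analysis_op :: "nat set \<Rightarrow> (nat \<Rightarrow> 'a \<Rightarrow> 'b) \<Rightarrow> 'a \<Rightarrow> 'b::real_inner ell2" where
  "analysis_op I A x = Abs_ell2 (\<lambda>i. if i \<in> I then A i x else 0)"

definition synthesis_op ::
  "('s::rc_field, 'a::real_inner) hspace \<Rightarrow> ('s, 'b::real_inner) hspace \<Rightarrow> nat set \<Rightarrow>
    (nat \<Rightarrow> 'a \<Rightarrow> 'b) \<Rightarrow> 'b ell2 \<Rightarrow> 'a" where
  "synthesis_op H K I A = adj H (ell2_space K) (analysis_op I A)"

definition frame_op ::
  "('s::rc_field, 'a::real_inner) hspace \<Rightarrow> ('s, 'b::real_inner) hspace \<Rightarrow> nat set \<Rightarrow>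
    (nat \<Rightarrow> 'a \<Rightarrow> 'b) \<Rightarrow> 'a \<Rightarrow> 'a" where
  "frame_op H K I A x = synthesis_op H K I A (analysis_op I A x)"

definition ker_synthesis ::
  "('s::rc_field, 'a::real_inner) hspace \<Rightarrow> ('s, 'b::real_inner) hspace \<Rightarrow> nat set \<Rightarrow>
    (nat \<Rightarrow> 'a \<Rightarrow> 'b) \<Rightarrow> 'b ell2 set" where
  "ker_synthesis H K I A = {y \<in> ell2_on I. synthesis_op H K I A y = 0}"

definition is_dual ::
  "('s::rc_field, 'a::real_inner) hspace \<Rightarrow> ('s, 'b::real_inner) hspace \<Rightarrow> nat set \<Rightarrow>
    (nat \<Rightarrow> 'a \<Rightarrow> 'b) \<Rightarrow> (nat \<Rightarrow> 'a \<Rightarrow> 'b) \<Rightarrow> bool" where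
  "is_dual H K I A A' \<longleftrightarrow>
     bessel H K I A' \<and> range_space H K I A' \<subseteq> range_space H K I A \<and>
     (\<forall>x\<in>range_space H K I A. ((\<lambda>i. adj H K (A' i) (A i x)) has_sum x) I)"

definition dual_params ::
  "('s::rc_field, 'a::real_inner) hspace \<Rightarrow> ('s, 'b::real_inner) hspace \<Rightarrow> nat set \<Rightarrow>
    (nat \<Rightarrow> 'a \<Rightarrow> 'b) \<Rightarrow> ('a \<Rightarrow> 'b ell2) set" where
  "dual_params H K I A =
     {L \<in> bounded_ops H (ell2_space K) (range_space H K I A) (ell2_on I).
        \<forall>x\<in>range_space H K I A. synthesis_op H K I A (L x) = 0}"

text \<open>
  The sequence with analysis operator \<open>(T (S|V)\<^sup>-\<^sup>1 + L) P\<close>, where \<open>V\<close> is the range space,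
  \<open>P\<close> the projection onto it, and \<open>T\<close>, \<open>S\<close> are the analysis and the frame operator of \<open>A\<close>:
  the members of a sequence are the coordinates of its analysis operator.
\<close>

definition dual_seq ::
  "('s::rc_field, 'a::real_inner) hspace \<Rightarrow> ('s, 'b::real_inner) hspace \<Rightarrow> nat set \<Rightarrow>
    (nat \<Rightarrow> 'a \<Rightarrow> 'b) \<Rightarrow> ('a \<Rightarrow> 'b ell2) \<Rightarrow> nat \<Rightarrow> 'a \<Rightarrow> 'b" where
  "dual_seq H K I A L i x =
     (let V = range_space H K I A; p = proj H V x
      in ell2_nth (analysis_op I A (inv_into V (frame_op H K I A) p) + L p) i)"

definition perturbation ::
  "('s::rc_field, 'a::real_inner) hspace \<Rightarrow> ('s, 'b::real_inner) hspace \<Rightarrow> nat set \<Rightarrow> real \<Rightarrow>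
    (nat \<Rightarrow> 'a \<Rightarrow> 'b) \<Rightarrow> (nat \<Rightarrow> 'a \<Rightarrow> 'b) \<Rightarrow> bool" where
  "perturbation H K I \<mu> A B \<longleftrightarrow>
     0 < \<mu> \<and> bessel H K I A \<and> bessel H K I B \<and>
     onorm (\<lambda>x. analysis_op I A x - analysis_op I B x) \<le> \<mu>"

end

theory Submission
  imports Defs
begin

text \<open>
  Write \<open>T\<close>, \<open>U\<close> for the analysis operators of \<open>A\<close>, \<open>B\<close>, and \<open>P\<close>, \<open>Q\<close> for the projections onto
  their range spaces. If the gap is less than 1, then \<open>Q\<close> maps the range space of \<open>A\<close> onto that of
  \<open>B\<close>, so the lower bound \<open>\<surd>\<alpha> - \<mu>\<close> of \<open>U\<close> on the former holds on the latter as well. With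
  \<open>F = (T (T\<^sup>*T)\<^sup>-\<^sup>1 + L) P\<close> and the canonical dual \<open>G = U (U\<^sup>*U)\<^sup>-\<^sup>1 Q\<close>, the projection onto the kernel of \<open>U\<^sup>*\<close> is
  \<open>1 - G U\<^sup>*\<close>, and \<open>T\<^sup>* F = P\<close> yields for the difference of the analysis operators of the duals
  \<open>F P (1 - Q) - G (1 - P) Q - G (T - U)\<^sup>* F Q\<close>.
  Its three terms are bounded by \<open>\<parallel>F\<parallel>\<Delta>\<close>, \<open>\<Delta> / (\<surd>\<alpha> - \<mu>)\<close> and \<open>\<mu>\<parallel>F\<parallel> / (\<surd>\<alpha> - \<mu>)\<close>, where
  \<open>\<parallel>F\<parallel> \<le> 1 / \<surd>\<alpha> + \<parallel>L\<parallel>\<close>; the sum is \<open>\<lambda>\<close>.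

  Orthogonality to a subspace over the scalar field and the adjoint of an operator over it can be
  tested with the real inner product alone, so that the operator theory is done over the reals.
\<close>

section \<open>Projections, Riesz representation and adjoints in real Hilbert spaces\<close>

text \<open>A sequence in \<open>V\<close> that minimizes the distance to \<open>x\<close> is Cauchy
  by the parallelogram law. Its limit is a nearest point, and moving that point along
  \<open>w\<close> cannot reduce the distance, which forces orthogonality.\<close>

lemma ex_orthogonal_projection:
  fixes V :: "'a::{real_inner,complete_space} set"
  assumes V: "subspace V" and cl: "closed V"
  shows "\<exists>p\<in>V. \<forall>v\<in>V. inner (x - p) v = 0"
proof -
  define d where "d = infdist x V"
  have ne: "V \<noteq> {}" using subspace_0[OF V] by blast
  have d: "0 \<le> d" "\<And>v. v \<in> V \<Longrightarrow> d \<le> norm (x - v)"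
    using infdist_le[of _ V x] by (auto simp: d_def infdist_nonneg dist_norm)
  have d2: "d\<^sup>2 \<le> (norm (x - v))\<^sup>2" if "v \<in> V" for v
    using d(1) d(2)[OF that] by (intro power_mono)
  have "\<exists>v\<in>V. (norm (x - v))\<^sup>2 < d\<^sup>2 + inverse (real (Suc n))" for n
  proof -
    have "d < sqrt (d\<^sup>2 + inverse (real (Suc n)))"
      by (rule real_less_rsqrt) simp
    then obtain v where v: "v \<in> V" "dist x v < sqrt (d\<^sup>2 + inverse (real (Suc n)))"
      using ne cINF_less_iff[of V "dist x" "sqrt (d\<^sup>2 + inverse (real (Suc n)))"]
      by (auto simp: d_def infdist_notempty)
    from v(2) have "(dist x v)\<^sup>2 < (sqrt (d\<^sup>2 + inverse (real (Suc n))))\<^sup>2"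
      by (intro power_strict_mono) auto
    then show ?thesis using v(1) by (auto simp: dist_norm)
  qed
  then obtain v where vV: "\<And>n. v n \<in> V"
    and vd: "\<And>n. (norm (x - v n))\<^sup>2 < d\<^sup>2 + inverse (real (Suc n))" by metis
  have close: "(norm (v m - v n))\<^sup>2 < 2 * inverse (real (Suc m)) + 2 * inverse (real (Suc n))" for m n
  proof -
    have "(1/2) *\<^sub>R (v m + v n) \<in> V" using V vV by (simp add: subspace_add subspace_scale)
    note d2[OF this]
    \<comment> \<open>Parallelogram law for \<open>x - v m\<close> and \<open>x - v n\<close>; the
      midpoint lies in \<open>V\<close>, so its squared distance to \<open>x\<close> is at least
      \<open>d\<^sup>2\<close>.\<close>
    moreover have "(norm (v m - v n))\<^sup>2 + 4 * (norm (x - (1/2) *\<^sub>R (v m + v n)))\<^sup>2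
        = 2 * (norm (x - v m))\<^sup>2 + 2 * (norm (x - v n))\<^sup>2"
      by (simp add: power2_norm_eq_inner inner_add_left inner_add_right inner_diff_left
          inner_diff_right inner_commute algebra_simps)
    ultimately show ?thesis using vd[of m] vd[of n] by linarith
  qed
  have "Cauchy v"
  proof (rule CauchyI)
    fix e :: real assume e: "e > 0"
    then obtain N where N: "inverse (real (Suc N)) < e\<^sup>2 / 4"
      using reals_Archimedean[of "e\<^sup>2/4"] by auto
    have "norm (v m - v n) < e" if "m \<ge> N" "n \<ge> N" for m n
    proof -
      have "inverse (real (Suc m)) \<le> inverse (real (Suc N))"
           "inverse (real (Suc n)) \<le> inverse (real (Suc N))" using that by auto
      then have "(norm (v m - v n))\<^sup>2 < e\<^sup>2" using close[of m n] N by linarith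
      then show ?thesis using e by (intro power2_less_imp_less[of _ e]) auto
    qed
    then show "\<exists>M. \<forall>m\<ge>M. \<forall>n\<ge>M. norm (v m - v n) < e" by blast
  qed
  then obtain p where p: "v \<longlonglongrightarrow> p" using Cauchy_convergent convergent_def by blast
  have pV: "p \<in> V" using closed_sequentially[OF cl] vV p by blast
  have "(\<lambda>n. d\<^sup>2 + inverse (real (Suc n))) \<longlonglongrightarrow> d\<^sup>2 + 0"
    by (intro tendsto_intros LIMSEQ_inverse_real_of_nat)
  moreover have "(\<lambda>n. (norm (x - v n))\<^sup>2) \<longlonglongrightarrow> (norm (x - p))\<^sup>2" by (intro tendsto_intros p)
  ultimately have pd: "(norm (x - p))\<^sup>2 \<le> d\<^sup>2"
    by (intro LIMSEQ_le[of "\<lambda>n. (norm (x - v n))\<^sup>2"]) (auto intro!: exI[of _ 0] less_imp_le[OF vd, simplified])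
  have "inner (x - p) w = 0" if w: "w \<in> V" for w
  proof (rule ccontr)
    define r where "r = inner (x - p) w"
    assume "inner (x - p) w \<noteq> 0"
    then have r: "r \<noteq> 0" and w0: "w \<noteq> 0" by (auto simp: r_def)
    \<comment> \<open>This \<open>t\<close> minimizes the distance from \<open>x - p\<close> to the
      multiples of \<open>w\<close>; the squared distance drops by \<open>t * r\<close>.\<close>
    define t where "t = r / (norm w)\<^sup>2"
    have "p + t *\<^sub>R w \<in> V" using V pV w by (simp add: subspace_add subspace_scale)
    from d2[OF this] have "(norm (x - p))\<^sup>2 \<le> (norm ((x - p) - t *\<^sub>R w))\<^sup>2"
      using pd order_trans[OF pd] by (simp only: diff_diff_eq)
    also have "\<dots> = (norm (x - p))\<^sup>2 - 2 * t * r + t\<^sup>2 * (norm w)\<^sup>2"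
      unfolding r_def power2_norm_eq_inner
      by (simp add: inner_diff_left inner_diff_right inner_commute power2_eq_square algebra_simps)
    also have "t\<^sup>2 * (norm w)\<^sup>2 = t * r" using w0 by (simp add: t_def power2_eq_square)
    finally have "t * r \<le> 0" by linarith
    moreover have "t * r > 0" using r w0 by (simp add: t_def flip: power2_eq_square)
    ultimately show False by linarith
  qed
  with pV show ?thesis by blast
qed

text \<open>The complement of the kernel of a nonzero \<open>f\<close> is spanned by one vector
  \<open>u\<close>, the component of \<open>x0\<close> orthogonal to the kernel. Every
  \<open>x\<close> is a multiple of \<open>u\<close> plus a kernel element, so \<open>f\<close> is a
  multiple of the inner product with \<open>u\<close>.\<close>

lemma riesz_representation:
  fixes f :: "'a::{real_inner,complete_space} \<Rightarrow> real"
  assumes f: "bounded_linear f"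
  shows "\<exists>z. \<forall>x. f x = inner x z"
proof (cases "\<forall>x. f x = 0")
  case True
  then show ?thesis by (intro exI[of _ 0]) simp
next
  case False
  then obtain x0 where x0: "f x0 \<noteq> 0" by blast
  interpret f: bounded_linear f by (rule f)
  define V where "V = {x. f x = 0}"
  have "subspace V" by (auto simp: V_def subspace_def f.zero f.add f.scaleR)
  moreover have "closed V"
    unfolding V_def by (intro closed_Collect_eq continuous_intros f.continuous_on)
  ultimately obtain p where p: "p \<in> V" "\<And>v. v \<in> V \<Longrightarrow> inner (x0 - p) v = 0"
    using ex_orthogonal_projection[of V x0] by blast
  define u where "u = x0 - p"
  have fu: "f u \<noteq> 0" using x0 p(1) by (simp add: u_def f.diff V_def)
  then have u: "u \<noteq> 0" using f.zero by metis
  have "f x = inner x ((f u / (norm u)\<^sup>2) *\<^sub>R u)" for x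
  proof -
    have "x - (f x / f u) *\<^sub>R u \<in> V" using fu by (simp add: V_def f.diff f.scaleR)
    from p(2)[OF this] have "inner u (x - (f x / f u) *\<^sub>R u) = 0" by (simp add: u_def)
    then have "inner x u = f x / f u * (norm u)\<^sup>2"
      by (simp add: inner_diff_right power2_norm_eq_inner inner_commute)
    then show ?thesis using fu u by simp
  qed
  then show ?thesis by blast
qed

lemma ex_adjoint_vector:
  fixes T :: "'a::{real_inner,complete_space} \<Rightarrow> 'b::real_inner"
  assumes "bounded_linear T"
  shows "\<exists>z. \<forall>x. inner (T x) y = inner x z"
  using riesz_representation[OF bounded_linear_compose[OF bounded_linear_inner_left assms]] by simp

lemma eq_if_inner_eq:
  fixes y z :: "'a::real_inner"
  assumes "\<And>x. inner x y = inner x z"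
  shows "y = z"
proof -
  have "inner (y - z) (y - z) = 0" using assms[of "y - z"] by (simp add: inner_diff_right)
  then show ?thesis by simp
qed

text \<open>The adjoint identity at \<open>Ts y\<close> gives
  \<open>norm (Ts y)\<^sup>2 = inner (T (Ts y)) y\<close>; Cauchy-Schwarz and division by
  \<open>norm (Ts y)\<close> finish.\<close>

lemma norm_adjoint_le:
  assumes adjoint: "\<And>x y. inner (T x) y = inner x (Ts y)"
    and T: "\<And>x. norm (T x) \<le> b * norm x" and b: "0 \<le> b"
  shows "norm (Ts y) \<le> b * norm y"
proof -
  have "norm (Ts y) * norm (Ts y) = inner (T (Ts y)) y"
    by (simp add: adjoint flip: power2_norm_eq_inner power2_eq_square)
  also have "\<dots> \<le> norm (T (Ts y)) * norm y" by (rule norm_cauchy_schwarz)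
  also have "\<dots> \<le> b * norm (Ts y) * norm y" by (intro mult_right_mono T) auto
  finally have "norm (Ts y) * norm (Ts y) \<le> norm (Ts y) * (b * norm y)" by (simp add: ac_simps)
  then show ?thesis using b by (cases "Ts y = 0") auto
qed

text \<open>Solutions of \<open>F x = y\<close> are the fixed points of the map sending
  \<open>x\<close> to \<open>y + (x - F x)\<close>, a contraction of the complete set
  \<open>V\<close>.\<close>

lemma surj_on_if_near_identity:
  fixes F :: "'a::{real_normed_vector,complete_space} \<Rightarrow> 'a"
  assumes V: "subspace V" "closed V" and F: "linear F" "\<And>x. x \<in> V \<Longrightarrow> F x \<in> V"
    and c: "c < 1" "\<And>x. x \<in> V \<Longrightarrow> norm (x - F x) \<le> c * norm x" and y: "y \<in> V"
  shows "\<exists>x\<in>V. F x = y"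
proof -
  \<comment> \<open>The fixed point theorem asks for a nonnegative factor, and \<open>c\<close> may
    be negative when \<open>V\<close> is trivial.\<close>
  define c' where "c' = max 0 c"
  have c': "0 \<le> c'" "c' < 1" "\<And>x. x \<in> V \<Longrightarrow> norm (x - F x) \<le> c' * norm x"
  proof -
    show "norm (x - F x) \<le> c' * norm x" if "x \<in> V" for x
      by (rule order_trans[OF c(2)[OF that]]) (auto simp: c'_def intro: mult_right_mono)
  qed (use c in \<open>auto simp: c'_def\<close>)
  have "\<exists>!x\<in>V. y + (x - F x) = x"
  proof (rule Banach_fix[OF _ _ c'(1,2)])
    show "complete V" using V(2) by (simp add: complete_eq_closed)
    show "V \<noteq> {}" using y by blast
    show "(\<lambda>x. y + (x - F x)) ` V \<subseteq> V"
      using V(1) F(2) y by (auto intro!: subspace_add subspace_diff)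
    show "dist (y + (x - F x)) (y + (z - F z)) \<le> c' * dist x z" if "x \<in> V" "z \<in> V" for x z
    proof -
      have "norm ((x - z) - F (x - z)) \<le> c' * norm (x - z)"
        using that V(1) by (intro c'(3) subspace_diff)
      then show ?thesis by (simp add: dist_norm linear_diff[OF F(1)] algebra_simps)
    qed
  qed
  then obtain x where "x \<in> V" "y + (x - F x) = x" by blast
  then show ?thesis by (intro bexI[of _ x]) (auto simp: algebra_simps)
qed

section \<open>Orthogonal projections described by the real inner product\<close>

text \<open>Membership and orthogonality of the remainder determine \<open>P\<close>; linearity and
  contractivity are derived from them. Only the real inner product occurs, so that
  \<open>proj H V\<close> is an instance over either scalar field.\<close>

locale orthogonal_projection =
  fixes V :: "'a::real_inner set" and P :: "'a \<Rightarrow> 'a"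
  assumes subspace: "subspace V"
    and mem [simp]: "P x \<in> V"
    and orth: "v \<in> V \<Longrightarrow> inner (x - P x) v = 0"
begin

lemma eqI:
  assumes "p \<in> V" "\<And>v. v \<in> V \<Longrightarrow> inner (x - p) v = 0"
  shows "P x = p"
proof -
  have v: "P x - p \<in> V" using assms(1) subspace by (simp add: subspace_diff)
  have "inner (P x - p) (P x - p) = inner (x - p) (P x - p) - inner (x - P x) (P x - p)"
    by (simp add: inner_diff_left)
  then show ?thesis using assms(2)[OF v] orth[OF v] by simp
qed

lemma ident: "v \<in> V \<Longrightarrow> P v = v"
  by (rule eqI) auto

lemma orth': "v \<in> V \<Longrightarrow> inner v (x - P x) = 0"
  using orth by (simp add: inner_commute)

lemma inner_eq: "v \<in> V \<Longrightarrow> inner v (P x) = inner v x"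
  using orth'[of v x] by (simp add: inner_diff_right)

lemma self_adjoint: "inner (P x) y = inner x (P y)"
  using inner_eq[of "P x" y] inner_eq[of "P y" x] by (simp add: inner_commute)

lemma pythagoras: "(norm x)\<^sup>2 = (norm (P x))\<^sup>2 + (norm (x - P x))\<^sup>2"
  using orth[of "P x" x] by (simp add: power2_norm_eq_inner inner_diff_left inner_diff_right
      inner_commute)

lemma norm_le: "norm (P x) \<le> norm x" "norm (x - P x) \<le> norm x"
  by (rule power2_le_imp_le; use pythagoras[of x] in simp)+

lemma bounded_linear: "bounded_linear P"
proof (rule bounded_linear_intro)
  show "P (x + y) = P x + P y" for x y
    by (rule eqI) (use subspace in \<open>simp_all add: subspace_add add_diff_add inner_add_left orth\<close>)
  show "P (r *\<^sub>R x) = r *\<^sub>R P x" for r x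
    by (rule eqI) (use subspace in \<open>simp_all add: subspace_scale orth flip: scaleR_diff_right\<close>)
  show "norm (P x) \<le> norm x * 1" for x using norm_le(1) by simp
qed

text \<open>The remainder \<open>y - P y\<close> lies in the kernel of \<open>P\<close>, hence is
  orthogonal to \<open>y\<close>. It is also orthogonal to \<open>P y\<close>, so it vanishes. This
  places ranges of adjoints inside \<open>V\<close>.\<close>

lemma mem_if_orth_to_complement:
  assumes "\<And>x. P x = 0 \<Longrightarrow> inner x y = 0"
  shows "y \<in> V"
proof -
  have "P (y - P y) = 0"
    using linear_diff[OF bounded_linear.linear[OF bounded_linear], of y "P y"] by (simp add: ident)
  from assms[OF this] have "inner (y - P y) (y - P y) = 0"
    using orth[of "P y" y] by (simp add: inner_diff_right)
  then have "y = P y" by simp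
  then show ?thesis using mem by metis
qed

end

section \<open>Frame operator and pseudo-inverse of an operator bounded below\<close>

text \<open>A bounded operator with closed range: \<open>V\<close> is the orthogonal complement of its kernel.\<close>

locale closed_range_operator = orthogonal_projection V P
  for V :: "'a::{real_inner,complete_space} set" and P +
  fixes T :: "'a \<Rightarrow> 'b::real_inner" and Ts :: "'b \<Rightarrow> 'a" and a :: real
  assumes closed: "closed V"
    and T: "bounded_linear T"
    and adjoint: "inner (T x) y = inner x (Ts y)"
    and kernel: "P x = 0 \<Longrightarrow> T x = 0"
    and a_pos: "0 < a"
    and lower: "x \<in> V \<Longrightarrow> a * norm x \<le> norm (T x)"
begin

sublocale T: bounded_linear T by (rule T)
sublocale P: bounded_linear P by (rule bounded_linear)

lemma adjoint_mem [simp]: "Ts y \<in> V"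
  by (rule mem_if_orth_to_complement) (simp add: kernel flip: adjoint)

lemma adjoint_linear: "linear Ts"
  by (rule linearI; rule eq_if_inner_eq) (simp_all add: inner_add_right flip: adjoint)

lemma inner_frame: "inner x (Ts (T y)) = inner (T x) (T y)"
  by (simp add: adjoint)

text \<open>Injectivity on \<open>V\<close> is the lower bound. For surjectivity the frame operator
  is scaled until it is a strict contraction away from the identity on \<open>V\<close>.\<close>

lemma frame_bij: "bij_betw (\<lambda>x. Ts (T x)) V V"
  unfolding bij_betw_def
proof
  show "inj_on (\<lambda>x. Ts (T x)) V"
  proof (rule inj_onI)
    fix x y assume xy: "x \<in> V" "y \<in> V" "Ts (T x) = Ts (T y)"
    then have "inner (x - y) (Ts (T (x - y))) = 0"
      by (simp add: T.diff linear_diff[OF adjoint_linear])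
    then have "T (x - y) = 0" by (simp add: inner_frame)
    then have "a * norm (x - y) \<le> 0"
      using lower[of "x - y"] xy subspace by (simp add: subspace_diff)
    then show "x = y" using a_pos by (simp add: mult_le_0_iff)
  qed
  have "p \<in> (\<lambda>x. Ts (T x)) ` V" if p: "p \<in> V" for p
  proof -
    obtain b where b: "b > 0" "\<And>x. norm (T x) \<le> norm x * b" using T.pos_bounded by blast
    \<comment> \<open>With this scaling \<open>t\<^sup>2 * (norm (Ts (T x)))\<^sup>2\<close> is at
      most \<open>t * (norm (T x))\<^sup>2\<close>, half of the cross term in the expansion of
      \<open>(norm (x - t *\<^sub>R Ts (T x)))\<^sup>2\<close>.\<close>
    define t where "t = 1 / b\<^sup>2"
    have t: "t > 0" "t * b\<^sup>2 = 1" using b(1) by (auto simp: t_def)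
    have Ts: "norm (Ts y) \<le> b * norm y" for y
      by (rule norm_adjoint_le[OF adjoint]) (use b in \<open>simp_all add: mult.commute\<close>)
    have "\<exists>x\<in>V. t *\<^sub>R Ts (T x) = t *\<^sub>R p"
    proof (rule surj_on_if_near_identity[OF subspace closed])
      show "linear (\<lambda>x. t *\<^sub>R Ts (T x))"
        by (intro linear_compose_scale_right linear_compose[unfolded o_def, OF T.linear adjoint_linear])
      \<comment> \<open>If \<open>V\<close> is trivial, \<open>a\<close> may exceed
        \<open>b\<close>; the root of a negative number is negative, so the bound still
        holds.\<close>
      show "sqrt (1 - t * a\<^sup>2) < 1" using t a_pos by simp
      fix x assume x: "x \<in> V"
      show "t *\<^sub>R Ts (T x) \<in> V" using subspace by (simp add: subspace_scale)
      have "(norm (Ts (T x)))\<^sup>2 \<le> b\<^sup>2 * (norm (T x))\<^sup>2"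
        using power_mono[OF Ts[of "T x"], of 2] by (simp add: power_mult_distrib)
      then have "t\<^sup>2 * (norm (Ts (T x)))\<^sup>2 \<le> t\<^sup>2 * (b\<^sup>2 * (norm (T x))\<^sup>2)"
        by (intro mult_left_mono) auto
      also have "\<dots> = t * (norm (T x))\<^sup>2 * (t * b\<^sup>2)" by (simp add: power2_eq_square)
      finally have "t\<^sup>2 * (norm (Ts (T x)))\<^sup>2 \<le> t * (norm (T x))\<^sup>2" using t by simp
      moreover have "t * (a * norm x)\<^sup>2 \<le> t * (norm (T x))\<^sup>2"
        using t a_pos lower[OF x] by (intro mult_left_mono power_mono) auto
      moreover have "(norm (x - t *\<^sub>R Ts (T x)))\<^sup>2
          = (norm x)\<^sup>2 - 2 * (t * (norm (T x))\<^sup>2) + t\<^sup>2 * (norm (Ts (T x)))\<^sup>2"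
        unfolding power2_norm_eq_inner
        by (simp add: inner_diff_left inner_diff_right inner_commute[of "Ts (T x)" x]
            inner_frame[of x x] power2_eq_square algebra_simps)
      ultimately have "(norm (x - t *\<^sub>R Ts (T x)))\<^sup>2 \<le> (norm x)\<^sup>2 - t * (a * norm x)\<^sup>2"
        by linarith
      also have "\<dots> = (1 - t * a\<^sup>2) * (norm x)\<^sup>2"
        by (simp add: power_mult_distrib algebra_simps)
      finally have "(norm (x - t *\<^sub>R Ts (T x)))\<^sup>2 \<le> (1 - t * a\<^sup>2) * (norm x)\<^sup>2" .
      then have "norm (x - t *\<^sub>R Ts (T x)) \<le> sqrt ((1 - t * a\<^sup>2) * (norm x)\<^sup>2)"
        by (rule real_le_rsqrt)
      then show "norm (x - t *\<^sub>R Ts (T x)) \<le> sqrt (1 - t * a\<^sup>2) * norm x"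
        by (simp add: real_sqrt_mult)
    next
      show "t *\<^sub>R p \<in> V" using p subspace by (simp add: subspace_scale)
    qed
    then show ?thesis using t by auto
  qed
  then show "(\<lambda>x. Ts (T x)) ` V = V" by auto
qed

text \<open>The same \<open>inv_into\<close> expression as in \<open>dual_seq\<close>; values
  outside \<open>V\<close> are irrelevant.\<close>

definition frame_inv :: "'a \<Rightarrow> 'a" where
  "frame_inv = inv_into V (\<lambda>x. Ts (T x))"

lemma frame_inv_mem [simp]: "p \<in> V \<Longrightarrow> frame_inv p \<in> V"
  and frame_frame_inv: "p \<in> V \<Longrightarrow> Ts (T (frame_inv p)) = p"
  using frame_bij
  by (auto simp: frame_inv_def bij_betw_def inv_into_into f_inv_into_f[of p "\<lambda>x. Ts (T x)" V])

lemma frame_inv_eqI: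
  assumes "x \<in> V" "Ts (T x) = p"
  shows "frame_inv p = x"
  using frame_bij assms inv_into_f_f[of "\<lambda>x. Ts (T x)" V x] by (auto simp: frame_inv_def bij_betw_def)

text \<open>The adjoint of the Moore-Penrose inverse of \<open>T\<close>. For the analysis operator
  of a frame sequence it is the analysis operator of the canonical dual.\<close>

definition pinv_adj :: "'a \<Rightarrow> 'b" where
  "pinv_adj x = T (frame_inv (P x))"

lemma adjoint_pinv_adj: "Ts (pinv_adj x) = P x"
  by (simp add: pinv_adj_def frame_frame_inv)

text \<open>For \<open>z = frame_inv (P x)\<close> the square of \<open>norm (T z)\<close> is
  \<open>inner z (P x)\<close>, at most \<open>norm z * norm x\<close>, and
  \<open>a * norm z\<close> is at most \<open>norm (T z)\<close>. This gives the constant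
  \<open>1 / a\<close>, independent of the norm of \<open>T\<close>.\<close>

lemma norm_pinv_adj: "a * norm (pinv_adj x) \<le> norm x"
proof -
  define z where "z = frame_inv (P x)"
  have z: "z \<in> V" "pinv_adj x = T z" by (auto simp: z_def pinv_adj_def)
  have "norm (T z) * norm (T z) = inner z (Ts (T z))"
    by (simp add: inner_frame flip: power2_norm_eq_inner power2_eq_square)
  also have "Ts (T z) = P x" by (simp add: z_def frame_frame_inv)
  also have "inner z (P x) \<le> norm z * norm x"
    using norm_cauchy_schwarz[of z "P x"] norm_le(1)[of x]
    by (meson mult_left_mono norm_ge_zero order_trans)
  finally have "a * (norm (T z) * norm (T z)) \<le> a * (norm z * norm x)"
    using a_pos by simp
  also have "\<dots> \<le> norm (T z) * norm x"
    using mult_right_mono[OF lower[OF z(1)], of "norm x"] by (simp add: mult.assoc)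
  finally have "norm (T z) * (a * norm (T z)) \<le> norm (T z) * norm x" by (simp add: algebra_simps)
  then show ?thesis using z(2) by (cases "T z = 0") auto
qed

lemma bounded_linear_pinv_adj: "bounded_linear pinv_adj"
proof (rule bounded_linear_intro)
  have sub: "subspace V" by (rule subspace)
  show "pinv_adj (x + y) = pinv_adj x + pinv_adj y" for x y
    unfolding pinv_adj_def T.add[symmetric] P.add
    by (rule arg_cong[where f = T], rule frame_inv_eqI)
      (auto simp: T.add linear_add[OF adjoint_linear] frame_frame_inv intro!: subspace_add[OF sub])
  show "pinv_adj (r *\<^sub>R x) = r *\<^sub>R pinv_adj x" for r x
    unfolding pinv_adj_def T.scaleR[symmetric] P.scaleR
    by (rule arg_cong[where f = T], rule frame_inv_eqI)
      (auto simp: T.scaleR linear_scale[OF adjoint_linear] frame_frame_inv intro!: subspace_scale[OF sub])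
  show "norm (pinv_adj x) \<le> norm x * (1 / a)" for x
    using norm_pinv_adj[of x] a_pos by (simp add: field_simps)
qed

lemma pinv_adj_P: "pinv_adj (P x) = pinv_adj x"
  by (simp add: pinv_adj_def ident)

text \<open>The map sending \<open>y\<close> to \<open>pinv_adj (Ts y)\<close> is the projection
  onto the range of \<open>T\<close>, whose complement is the kernel of \<open>Ts\<close>.\<close>

lemma adjoint_minus_range_projection: "Ts (y - pinv_adj (Ts y)) = 0"
  by (simp add: linear_diff[OF adjoint_linear] adjoint_pinv_adj ident)

end

section \<open>Norm estimates for two subspaces with small gap\<close>

text \<open>Since the gap is less than 1, the projection onto \<open>W\<close> maps \<open>V\<close> onto \<open>W\<close>, and it is
  norm-decreasing; so the lower bound on \<open>V\<close> is inherited by \<open>W\<close> without loss.\<close>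

lemma lower_bound_transfer:
  fixes U :: "'a::{real_inner,complete_space} \<Rightarrow> 'b::real_normed_vector"
  assumes "orthogonal_projection V P" "orthogonal_projection W Q" and W: "closed W"
    and UQ: "\<And>x. U (Q x) = U x"
    and gap: "\<And>w. w \<in> W \<Longrightarrow> norm (w - P w) \<le> \<delta> * norm w" "\<delta> < 1"
    and lower: "\<And>x. x \<in> V \<Longrightarrow> b * norm x \<le> norm (U x)" "0 \<le> b" and y: "y \<in> W"
  shows "b * norm y \<le> norm (U y)"
proof -
  interpret P: orthogonal_projection V P by fact
  interpret Q: orthogonal_projection W Q by fact
  interpret LP: bounded_linear P by (rule P.bounded_linear)
  interpret LQ: bounded_linear Q by (rule Q.bounded_linear)
  \<comment> \<open>On \<open>W\<close> the map \<open>Q P\<close> differs from the identity by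
    \<open>Q (w - P w)\<close>, so it is onto \<open>W\<close>.\<close>
  have "\<exists>w\<in>W. Q (P w) = y"
  proof (rule surj_on_if_near_identity[OF Q.subspace W _ _ gap(2) _ y])
    show "linear (\<lambda>w. Q (P w))"
      using linear_compose[OF LP.linear LQ.linear] by (simp add: o_def)
    fix w assume w: "w \<in> W"
    have "norm (w - Q (P w)) = norm (Q (w - P w))" using w by (simp add: LQ.diff Q.ident)
    also have "\<dots> \<le> norm (w - P w)" by (rule Q.norm_le)
    also have "\<dots> \<le> \<delta> * norm w" by (rule gap(1)[OF w])
    finally show "norm (w - Q (P w)) \<le> \<delta> * norm w" .
  qed auto
  then obtain w where w: "y = Q (P w)" by blast
  have "b * norm y \<le> b * norm (P w)" unfolding w using lower(2) by (intro mult_left_mono Q.norm_le)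
  also have "\<dots> \<le> norm (U (P w))" by (rule lower(1)) simp
  also have "U (P w) = U y" by (simp add: w UQ)
  finally show ?thesis .
qed

text \<open>The operator \<open>P (1 - Q)\<close> is the adjoint of \<open>(1 - Q) P\<close>, and
  the gap hypothesis on \<open>V\<close> bounds the latter. The proof is the norm estimate for
  adjoints with test vector \<open>P d\<close>.\<close>

lemma norm_projection_complement_le:
  assumes "orthogonal_projection V P" "orthogonal_projection W Q"
    and gap: "\<And>v. v \<in> V \<Longrightarrow> norm (v - Q v) \<le> \<delta> * norm v" and \<delta>: "0 \<le> \<delta>"
  shows "norm (P (x - Q x)) \<le> \<delta> * norm x"
proof -
  interpret P: orthogonal_projection V P by fact
  interpret Q: orthogonal_projection W Q by fact
  define d where "d = x - Q x"
  have "norm (P d) * norm (P d) = inner (P d) d"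
    using P.inner_eq[of "P d" d] by (simp flip: power2_norm_eq_inner power2_eq_square)
  also have "\<dots> = inner (P d - Q (P d)) d"
    unfolding d_def by (simp add: inner_diff_left Q.orth' flip: inner_diff_right)
  also have "\<dots> \<le> norm (P d - Q (P d)) * norm d" by (rule norm_cauchy_schwarz)
  also have "\<dots> \<le> (\<delta> * norm (P d)) * norm x"
    unfolding d_def using \<delta> by (intro mult_mono gap Q.norm_le) auto
  finally have "norm (P d) * norm (P d) \<le> norm (P d) * (\<delta> * norm x)" by (simp add: ac_simps)
  then show ?thesis using \<delta> by (cases "P d = 0") (auto simp: d_def)
qed

text \<open>\<open>T\<close> is the perturbed operator and \<open>S\<close> the original one; with \<open>G\<close> for \<open>pinv_adj\<close>, the difference is
  \<open>F Q (1 - P) - G (1 - Q) P - G (S - T)\<^sup>* F P\<close>.\<close>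

lemma (in closed_range_operator) dual_perturbation_bound:
  assumes "orthogonal_projection W Q"
    and F: "linear F" "\<And>x. F (Q x) = F x" "\<And>x. norm (F x) \<le> f * norm x" "0 \<le> f"
    and S: "\<And>x y. inner (S x) y = inner x (Ss y)" "\<And>x. Ss (F x) = Q x"
    and close: "\<And>x. norm (S x - T x) \<le> \<mu> * norm x" "0 \<le> \<mu>"
    and gap: "\<And>w. w \<in> W \<Longrightarrow> norm (w - P w) \<le> \<delta> * norm w"
      "\<And>v. v \<in> V \<Longrightarrow> norm (v - Q v) \<le> \<delta> * norm v" "0 \<le> \<delta>"
  shows "norm (F x - (pinv_adj x + (F (P x) - pinv_adj (Ts (F (P x))))))
    \<le> (f * \<delta> + (\<delta> + \<mu> * f) / a) * norm x"
proof -
  interpret Q: orthogonal_projection W Q by fact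
  interpret G: bounded_linear pinv_adj by (rule bounded_linear_pinv_adj)
  interpret LQ: bounded_linear Q by (rule Q.bounded_linear)
  \<comment> \<open>As \<open>Ss (F (P x)) = Q (P x)\<close>, the vector \<open>u\<close> telescopes
    to \<open>P x - Ts (F (P x))\<close>. In this form one bracket is controlled by the gap and the
    other by the perturbation.\<close>
  define u where "u = (P x - Q (P x)) + (Ss (F (P x)) - Ts (F (P x)))"
  have eq: "F x - (pinv_adj x + (F (P x) - pinv_adj (Ts (F (P x))))) = F (Q (x - P x)) - pinv_adj u"
    by (simp add: u_def S(2) F(2) linear_diff[OF F(1)] G.diff pinv_adj_P)
  have "norm (F (Q (x - P x))) \<le> f * norm (Q (x - P x))" by (rule F(3))
  also have "\<dots> \<le> f * (\<delta> * norm x)"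
    using F(4) gap by (intro mult_left_mono
        norm_projection_complement_le[OF assms(1) orthogonal_projection_axioms])
  finally have 1: "norm (F (Q (x - P x))) \<le> f * \<delta> * norm x" by simp
  have "norm (P x - Q (P x)) \<le> \<delta> * norm (P x)" by (rule gap) simp
  also have "\<dots> \<le> \<delta> * norm x" using gap(3) by (intro mult_left_mono norm_le)
  finally have 2: "norm (P x - Q (P x)) \<le> \<delta> * norm x" .
  have "norm (Ss (F (P x)) - Ts (F (P x))) \<le> \<mu> * norm (F (P x))"
    using close by (intro norm_adjoint_le[of "\<lambda>x. S x - T x" "\<lambda>y. Ss y - Ts y"])
      (auto simp: inner_diff_left inner_diff_right S(1) adjoint)
  also have "\<dots> \<le> \<mu> * (f * norm (P x))" using close(2) by (intro mult_left_mono F)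
  also have "\<dots> \<le> \<mu> * (f * norm x)" using close(2) F(4) by (intro mult_left_mono norm_le)
  finally have 3: "norm (Ss (F (P x)) - Ts (F (P x))) \<le> \<mu> * f * norm x" by simp
  have "a * norm (pinv_adj u) \<le> norm u" by (rule norm_pinv_adj)
  also have "\<dots> \<le> (\<delta> + \<mu> * f) * norm x"
    unfolding u_def using norm_triangle_ineq[of "P x - Q (P x)" "Ss (F (P x)) - Ts (F (P x))"] 2 3
    by (simp add: distrib_right)
  finally have 4: "norm (pinv_adj u) \<le> (\<delta> + \<mu> * f) / a * norm x"
    using a_pos by (simp add: field_simps)
  show ?thesis
    unfolding eq using norm_triangle_ineq4[of "F (Q (x - P x))" "pinv_adj u"] 1 4
    by (simp add: distrib_right)
qed

section \<open>Reduction of the scalar-valued inner product to the real one\<close>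

lemma sconj_diff: "sconj (x - y) = sconj x - sconj (y::'a::rc_field)"
  using sconj_add[of "x - y" y] by (simp add: eq_diff_eq)

text \<open>The conjugate-symmetric part plays the role of the real part.\<close>

lemma eq_if_real_parts_eq:
  fixes a b :: "'a::rc_field"
  assumes "\<And>c. c * a + sconj (c * a) = c * b + sconj (c * b)"
  shows "a = b"
proof -
  define r where "r = (norm (a - b))\<^sup>2"
  have r: "sconj (a - b) * (a - b) = of_real r"
    using mult_sconj[of "a - b"] by (simp add: mult.commute r_def scaleR_conv_of_real)
  have "c * (a - b) + sconj (c * (a - b)) = 0" for c
    using assms[of c] by (simp add: right_diff_distrib sconj_diff algebra_simps)
  \<comment> \<open>This choice of \<open>c\<close> makes \<open>c * (a - b)\<close> the real number
    \<open>r\<close>, so its conjugate-symmetric part is \<open>2 * r\<close>.\<close>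
  from this[of "sconj (a - b)"] have "of_real (r + r) = (0::'a)"
    unfolding r sconj_of_real by simp
  then have "r = 0" by (simp only: of_real_eq_0_iff)
  then show ?thesis by (simp add: r_def)
qed

lemma bounded_opsD:
  assumes "T \<in> bounded_ops H K V W"
  shows "x \<in> V \<Longrightarrow> T x \<in> W" "x \<in> V \<Longrightarrow> y \<in> V \<Longrightarrow> T (x + y) = T x + T y"
    "x \<in> V \<Longrightarrow> T (smult H c x) = smult K c (T x)" "\<exists>C\<ge>0. \<forall>x\<in>V. norm (T x) \<le> C * norm x"
proof -
  obtain C where C: "\<And>x. x \<in> V \<Longrightarrow> norm (T x) \<le> C * norm x"
    using assms unfolding bounded_ops_def by blast
  have "norm (T x) \<le> \<bar>C\<bar> * norm x" if "x \<in> V" for x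
    using C[OF that] by (rule order_trans) (auto intro: mult_right_mono)
  then show "\<exists>C\<ge>0. \<forall>x\<in>V. norm (T x) \<le> C * norm x" by (intro exI[of _ "\<bar>C\<bar>"]) auto
qed (use assms in \<open>auto simp: bounded_ops_def\<close>)

context hilbert_space
begin

sublocale vs: vector_space "smult H" by (rule vector_space_smult)

text \<open>Polarization: expanding \<open>ip H (x + y) (x + y)\<close> expresses twice the real
  part of \<open>ip H x y\<close> through norms, and these also determine
  \<open>inner x y\<close>.\<close>

lemma ip_plus_conj: "ip H x y + sconj (ip H x y) = of_real (2 * inner x y)"
proof -
  have "ip H (x + y) (x + y) = ip H x x + ip H y y + (ip H x y + sconj (ip H x y))"
    by (simp add: ip_add_left ip_add_right ip_commute[of y x])
  then have "ip H x y + sconj (ip H x y) = of_real ((norm (x + y))\<^sup>2 - (norm x)\<^sup>2 - (norm y)\<^sup>2)"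
    by (simp add: ip_self algebra_simps)
  also have "(norm (x + y))\<^sup>2 - (norm x)\<^sup>2 - (norm y)\<^sup>2 = 2 * inner x y"
    by (simp add: power2_norm_eq_inner inner_add_left inner_add_right inner_commute)
  finally show ?thesis .
qed

text \<open>Multiplying the first argument by all scalars \<open>c\<close> recovers a scalar from
  the real parts of its multiples. Identities for \<open>ip\<close> thus reduce to identities for
  \<open>inner\<close>.\<close>

lemma ip_eq_ip_iff:
  assumes "hilbert_space K"
  shows "ip H x y = ip K u v \<longleftrightarrow> (\<forall>c. inner (smult H c x) y = inner (smult K c u) v)"
proof -
  interpret K: hilbert_space K by fact
  have iff: "c * ip H x y + sconj (c * ip H x y) = c * ip K u v + sconj (c * ip K u v) \<longleftrightarrow>
      inner (smult H c x) y = inner (smult K c u) v" for c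
    unfolding ip_smult_left[symmetric] K.ip_smult_left[symmetric] ip_plus_conj K.ip_plus_conj
    by (simp only: of_real_eq_iff) simp
  show ?thesis
    using eq_if_real_parts_eq[of "ip H x y" "ip K u v"] iff by metis
qed

lemma inner_eq_if_ip_eq:
  assumes "hilbert_space K" "ip H x y = ip K u v"
  shows "inner x y = inner u v"
proof -
  interpret K: hilbert_space K by fact
  have "inner (smult H 1 x) y = inner (smult K 1 u) v"
    using assms(2) unfolding ip_eq_ip_iff[OF assms(1)] by blast
  then show ?thesis by simp
qed

lemma ip_zero_left [simp]: "ip H 0 y = 0"
  using ip_smult_left[of 0 0 y] by simp

lemma subspace_real: "vs.subspace V \<Longrightarrow> subspace V"
  unfolding vs.subspace_def subspace_def by (metis smult_of_real)

text \<open>\<open>V\<close> contains all scalar multiples of \<open>v\<close>, so real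
  orthogonality to \<open>V\<close> annihilates every real part needed to determine
  \<open>ip H v x\<close>.\<close>

lemma ip_orth_iff:
  assumes V: "vs.subspace V"
  shows "(\<forall>v\<in>V. ip H x v = 0) \<longleftrightarrow> (\<forall>v\<in>V. inner x v = 0)"
proof
  assume *: "\<forall>v\<in>V. ip H x v = 0"
  show "\<forall>v\<in>V. inner x v = 0"
    using inner_eq_if_ip_eq[OF hilbert_space_axioms, of x _ 0 0] * by simp
next
  assume *: "\<forall>v\<in>V. inner x v = 0"
  show "\<forall>v\<in>V. ip H x v = 0"
  proof
    fix v assume v: "v \<in> V"
    have "inner (smult H c v) x = inner (smult H c 0) 0" for c
      using * vs.subspace_scale[OF V v] by (subst inner_commute) simp
    then have "ip H v x = ip H 0 0" unfolding ip_eq_ip_iff[OF hilbert_space_axioms] by blast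
    then show "ip H x v = 0" by (simp add: ip_commute[of x v])
  qed
qed

lemma proj_eqI:
  assumes V: "vs.subspace V" and p: "p \<in> V" "\<And>v. v \<in> V \<Longrightarrow> inner (x - p) v = 0"
  shows "proj H V x = p"
  unfolding proj_def ip_orth_iff[OF V]
proof (rule the_equality)
  show "p \<in> V \<and> (\<forall>v\<in>V. inner (x - p) v = 0)" using p by blast
  fix q assume q: "q \<in> V \<and> (\<forall>v\<in>V. inner (x - q) v = 0)"
  then have d: "q - p \<in> V" using p(1) V by (simp add: vs.subspace_diff)
  have "inner (q - p) (q - p) = inner (x - p) (q - p) - inner (x - q) (q - p)"
    by (simp add: inner_diff_left)
  then show "q = p" using p(2)[OF d] q d by simp
qed

lemma proj_orthogonal_projection:
  assumes V: "vs.subspace V" "closed V"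
  shows "orthogonal_projection V (proj H V)"
proof -
  have "proj H V x \<in> V \<and> (\<forall>v\<in>V. inner (x - proj H V x) v = 0)" for x
  proof -
    obtain p where p: "p \<in> V" "\<And>v. v \<in> V \<Longrightarrow> inner (x - p) v = 0"
      using ex_orthogonal_projection[OF subspace_real[OF V(1)] V(2)] by blast
    then show ?thesis using proj_eqI[OF V(1) p] by simp
  qed
  then show ?thesis by unfold_locales (use V subspace_real in auto)
qed

lemma proj_smult:
  assumes V: "vs.subspace V" "closed V"
  shows "proj H V (smult H c x) = smult H c (proj H V x)"
proof -
  interpret P: orthogonal_projection V "proj H V" by (rule proj_orthogonal_projection[OF V])
  have "\<forall>v\<in>V. ip H (x - proj H V x) v = 0" using P.orth ip_orth_iff[OF V(1)] by blast
  then have "\<forall>v\<in>V. ip H (smult H c (x - proj H V x)) v = 0" by (simp add: ip_smult_left)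
  then show ?thesis
    by (intro proj_eqI[OF V(1)])
      (auto simp: ip_orth_iff[OF V(1)] vs.scale_right_diff_distrib vs.subspace_scale[OF V(1)])
qed

lemma bounded_linear_smult: "bounded_linear (smult H c)"
proof (rule bounded_linear_intro)
  show "smult H c (r *\<^sub>R x) = r *\<^sub>R smult H c x" for r x
    by (simp add: mult.commute flip: smult_of_real)
  show "norm (smult H c x) \<le> norm x * norm c" for x by (simp add: norm_smult mult.commute)
qed (simp add: vs.scale_right_distrib)

lemma subspace_closure:
  assumes V: "vs.subspace V"
  shows "vs.subspace (closure V)"
proof (rule vs.subspaceI)
  show "0 \<in> closure V" using vs.subspace_0[OF V] closure_subset by blast
  show "x + y \<in> closure V" if "x \<in> closure V" "y \<in> closure V" for x y
  proof -
    obtain f g where fg: "\<And>n. f n \<in> V" "f \<longlonglongrightarrow> x" "\<And>n. g n \<in> V" "g \<longlonglongrightarrow> y"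
      using \<open>x \<in> closure V\<close> \<open>y \<in> closure V\<close> by (auto simp: closure_sequential)
    then show ?thesis
      unfolding closure_sequential using vs.subspace_add[OF V]
      by (intro exI[of _ "\<lambda>n. f n + g n"]) (auto intro: tendsto_add)
  qed
  show "smult H c x \<in> closure V" if "x \<in> closure V" for c x
    using closure_bounded_linear_image_subset[OF bounded_linear_smult, of c V] that
      closure_mono[of "smult H c ` V" V] vs.subspace_scale[OF V] by blast
qed

lemma bounded_ops_UNIV_iff:
  assumes "hilbert_space K"
  shows "T \<in> bounded_ops H K UNIV W \<longleftrightarrow>
    bounded_linear T \<and> (\<forall>c x. T (smult H c x) = smult K c (T x)) \<and> (\<forall>x. T x \<in> W)"
proof -
  interpret K: hilbert_space K by fact
  have "T (r *\<^sub>R x) = r *\<^sub>R T x" if "\<And>c x. T (smult H c x) = smult K c (T x)" for r x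
    using that[of "of_real r" x] by (simp add: smult_of_real K.smult_of_real)
  then show ?thesis
    unfolding bounded_ops_def bounded_linear_def linear_iff bounded_linear_axioms_def
    by (auto simp: mult.commute)
qed

text \<open>The vector supplied by the real Riesz theorem also satisfies the identity for
  \<open>ip\<close>, because \<open>T\<close> commutes with scalars. It is therefore the unique
  object that \<open>adj\<close> describes.\<close>

lemma adj:
  assumes "hilbert_space K" and T: "T \<in> bounded_ops H K UNIV UNIV"
  shows ip_adj: "ip K (T x) y = ip H x (adj H K T y)"
    and inner_adj: "inner (T x) y = inner x (adj H K T y)"
proof -
  interpret K: hilbert_space K by fact
  have T': "bounded_linear T" "\<And>c x. T (smult H c x) = smult K c (T x)"
    using T bounded_ops_UNIV_iff[OF assms(1)] by auto
  obtain z where z: "\<And>x. inner (T x) y = inner x z" using ex_adjoint_vector[OF T'(1)] by blast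
  have ip: "ip K (T x) y = ip H x z" for x
    unfolding K.ip_eq_ip_iff[OF hilbert_space_axioms] by (simp add: z flip: T'(2))
  have "adj H K T y = z"
    unfolding adj_def
  proof (rule the_equality)
    fix w assume "\<forall>x. ip K (T x) y = ip H x w"
    then have "inner x w = inner x z" for x
      using inner_eq_if_ip_eq[OF hilbert_space_axioms, of x w x z] ip by simp
    then show "w = z" by (rule eq_if_inner_eq)
  qed (use ip in blast)
  then show "ip K (T x) y = ip H x (adj H K T y)" "inner (T x) y = inner x (adj H K T y)"
    using ip z by auto
qed

lemma adj_bounded_ops:
  assumes "hilbert_space K" and T: "T \<in> bounded_ops H K UNIV UNIV"
  shows "adj H K T \<in> bounded_ops K H UNIV UNIV"
proof -
  interpret K: hilbert_space K by fact
  note inner = inner_adj[OF assms] and ip = ip_adj[OF assms]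
  obtain C where C: "C \<ge> 0" "\<And>x. norm (T x) \<le> C * norm x" using bounded_opsD(4)[OF T] by auto
  show ?thesis
    unfolding bounded_ops_def
  proof (intro CollectI conjI ballI allI)
    show "adj H K T (x + y) = adj H K T x + adj H K T y" for x y
      by (rule eq_if_inner_eq) (simp add: inner_add_right flip: inner)
    show "adj H K T (smult K c y) = smult H c (adj H K T y)" for c y
    proof (rule eq_if_inner_eq, rule inner_eq_if_ip_eq[OF hilbert_space_axioms])
      show "ip H x (adj H K T (smult K c y)) = ip H x (smult H c (adj H K T y))" for x
        by (simp add: ip_smult_right K.ip_smult_right flip: ip)
    qed
    show "\<exists>C. \<forall>y\<in>UNIV. norm (adj H K T y) \<le> C * norm y"
      using norm_adjoint_le[OF inner C(2,1)] by blast
  qed auto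
qed

text \<open>Composition with the projection extends an operator given only on \<open>V\<close> to
  the whole space.\<close>

lemma bounded_ops_proj:
  assumes "hilbert_space K" and V: "vs.subspace V" "closed V" and L: "L \<in> bounded_ops H K V W"
  shows "(\<lambda>x. L (proj H V x)) \<in> bounded_ops H K UNIV W"
proof -
  interpret P: orthogonal_projection V "proj H V" by (rule proj_orthogonal_projection[OF V])
  obtain C where C: "C \<ge> 0" "\<And>x. x \<in> V \<Longrightarrow> norm (L x) \<le> C * norm x"
    using bounded_opsD(4)[OF L] by auto
  have "norm (L (proj H V x)) \<le> C * norm x" for x
    using C(2)[OF P.mem] mult_left_mono[OF P.norm_le(1) C(1)] by (rule order_trans)
  moreover have "proj H V (x + y) = proj H V x + proj H V y" for x y
    using P.bounded_linear by (simp add: bounded_linear.linear linear_add)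
  ultimately show ?thesis
    using bounded_opsD(1-3)[OF L] by (auto simp: bounded_ops_def proj_smult[OF V])
qed

end

section \<open>Norms and algebra of bounded operators\<close>

text \<open>Boundedness of \<open>T\<close> bounds the quotients above, so their supremum is a
  genuine operator bound. The quotient at 0 is 0 by the convention for division, which makes the
  supremum nonnegative.\<close>

lemma onorm_on:
  assumes T: "T \<in> bounded_ops H K V W"
  shows norm_le_onorm_on: "x \<in> V \<Longrightarrow> norm (T x) \<le> onorm_on V T * norm x"
    and onorm_on_nonneg: "0 \<in> V \<Longrightarrow> 0 \<le> onorm_on V T"
proof -
  obtain C where C: "C \<ge> 0" "\<And>x. x \<in> V \<Longrightarrow> norm (T x) \<le> C * norm x"
    using bounded_opsD(4)[OF T] by auto
  have "bdd_above ((\<lambda>x. norm (T x) / norm x) ` V)"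
  proof (rule bdd_aboveI2)
    show "norm (T x) / norm x \<le> C" if "x \<in> V" for x
      using C(2)[OF that] C(1) by (cases "x = 0") (auto simp: divide_simps)
  qed
  then have *: "norm (T x) / norm x \<le> onorm_on V T" if "x \<in> V" for x
    unfolding onorm_on_def using that by (rule cSUP_upper2) simp
  show "norm (T x) \<le> onorm_on V T * norm x" if "x \<in> V"
    using *[OF that] C(2)[OF that] by (cases "x = 0") (simp_all add: divide_simps)
  show "0 \<le> onorm_on V T" if "0 \<in> V" using *[OF that] by simp
qed

lemma bounded_ops_compose:
  assumes "hilbert_space H" "hilbert_space K" "hilbert_space E"
    and T: "T \<in> bounded_ops H K UNIV V" and S: "S \<in> bounded_ops K E UNIV W"
  shows "(\<lambda>x. S (T x)) \<in> bounded_ops H E UNIV W"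
  using T S bounded_linear_compose[of S T] unfolding hilbert_space.bounded_ops_UNIV_iff[OF assms(1,2)]
    hilbert_space.bounded_ops_UNIV_iff[OF assms(2,3)] hilbert_space.bounded_ops_UNIV_iff[OF assms(1,3)]
  by simp

lemma bounded_ops_add_diff:
  assumes "hilbert_space H" "hilbert_space K" and W: "module.subspace (smult K) W"
    and T: "T \<in> bounded_ops H K UNIV W" and S: "S \<in> bounded_ops H K UNIV W"
  shows "(\<lambda>x. T x + S x) \<in> bounded_ops H K UNIV W" "(\<lambda>x. T x - S x) \<in> bounded_ops H K UNIV W"
proof -
  interpret K: hilbert_space K by fact
  show "(\<lambda>x. T x + S x) \<in> bounded_ops H K UNIV W" "(\<lambda>x. T x - S x) \<in> bounded_ops H K UNIV W"
    using T S unfolding hilbert_space.bounded_ops_UNIV_iff[OF assms(1,2)]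
    by (auto simp: bounded_linear_add bounded_linear_sub K.vs.scale_right_distrib
        K.vs.scale_right_diff_distrib K.vs.subspace_add[OF W] K.vs.subspace_diff[OF W])
qed

lemma bounded_ops_mono: "W \<subseteq> W' \<Longrightarrow> T \<in> bounded_ops H K V W \<Longrightarrow> T \<in> bounded_ops H K V W'"
  unfolding bounded_ops_def by blast

lemma bounded_ops_restrict: "V' \<subseteq> V \<Longrightarrow> T \<in> bounded_ops H K V W \<Longrightarrow> T \<in> bounded_ops H K V' W"
  unfolding bounded_ops_def by blast

section \<open>Square-summable sequences supported in the index set\<close>

lemma subspace_ell2_on:
  assumes "hilbert_space K"
  shows "module.subspace (smult (ell2_space K)) (ell2_on I)"
proof -
  interpret K: hilbert_space K by fact
  interpret E: hilbert_space "ell2_space K" by (rule hilbert_space_ell2) fact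
  show ?thesis
    by (rule E.vs.subspaceI)
      (auto simp: ell2_on_def zero_ell2.rep_eq plus_ell2.rep_eq K.ell2_smult_nth)
qed

lemma has_sum_norm_ell2_on:
  assumes "f \<in> ell2_on I"
  shows "((\<lambda>i. (norm (ell2_nth f i))\<^sup>2) has_sum (norm f)\<^sup>2) I"
proof -
  have "((\<lambda>i. (norm (ell2_nth f i))\<^sup>2) has_sum (norm f)\<^sup>2) UNIV"
    unfolding norm_ell2_power2 by (intro has_sum_infsum ell2_nth_summable)
  then show ?thesis
    by (rule has_sum_cong_neutral[THEN iffD1, rotated -1]) (use assms in \<open>auto simp: ell2_on_def\<close>)
qed

text \<open>This is the surjectivity of the correspondence between Bessel sequences and bounded
  operators into \<open>ell2_on I\<close>. Through it a dual can be studied by its analysis operator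
  alone.\<close>

lemma bessel_coordinates:
  assumes "hilbert_space H" "hilbert_space K" and F: "F \<in> bounded_ops H (ell2_space K) UNIV (ell2_on I)"
  shows "bessel H K I (\<lambda>i x. ell2_nth (F x) i)" "analysis_op I (\<lambda>i x. ell2_nth (F x) i) = F"
proof -
  interpret H: hilbert_space H by fact
  interpret K: hilbert_space K by fact
  obtain C where C: "C \<ge> 0" "\<And>x. norm (F x) \<le> C * norm x" using bounded_opsD(4)[OF F] by auto
  have on: "F x \<in> ell2_on I" for x using bounded_opsD(1)[OF F] by simp
  note sum = has_sum_norm_ell2_on[OF on]
  show "analysis_op I (\<lambda>i x. ell2_nth (F x) i) = F"
  proof
    fix x
    have "(\<lambda>i. if i \<in> I then ell2_nth (F x) i else 0) = ell2_nth (F x)"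
      using on[of x] by (auto simp: ell2_on_def fun_eq_iff)
    then show "analysis_op I (\<lambda>i x. ell2_nth (F x) i) x = F x"
      by (simp add: analysis_op_def ell2_nth_inverse)
  qed
  \<comment> \<open>A Bessel bound has to be positive, while \<open>C\<close> may be 0.\<close>
  have "(norm (F x))\<^sup>2 \<le> (C\<^sup>2 + 1) * (norm x)\<^sup>2" for x
  proof -
    have "(norm (F x))\<^sup>2 \<le> (C * norm x)\<^sup>2" by (intro power_mono C) auto
    then show ?thesis by (simp add: power_mult_distrib distrib_right add_increasing2)
  qed
  moreover have "C\<^sup>2 + 1 > 0" by (simp add: add_nonneg_pos)
  moreover have "(\<lambda>x. ell2_nth (F x) i) \<in> bounded_ops H K UNIV UNIV" for i
    unfolding bounded_ops_def
  proof (intro CollectI conjI ballI allI)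
    show "\<exists>C. \<forall>x\<in>UNIV. norm (ell2_nth (F x) i) \<le> C * norm x"
      using order_trans[OF norm_ell2_nth_le C(2)] by blast
  qed (simp_all add: bounded_opsD[OF F] plus_ell2.rep_eq K.ell2_smult_nth)
  ultimately show "bessel H K I (\<lambda>i x. ell2_nth (F x) i)"
    unfolding bessel_def
    by (auto intro!: exI[of _ "C\<^sup>2 + 1"] has_sum_imp_summable[OF sum] simp: infsumI[OF sum])
qed

section \<open>Analysis and synthesis operators of Bessel sequences\<close>

locale bessel_sequence = H: hilbert_space H + K: hilbert_space K
  for H :: "('s::rc_field, 'h::{real_inner,complete_space}) hspace"
    and K :: "('s, 'k::{real_inner,complete_space}) hspace" +
  fixes I :: "nat set" and A :: "nat \<Rightarrow> 'h \<Rightarrow> 'k"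
  assumes bessel: "bessel H K I A"
begin

sublocale E: hilbert_space "ell2_space K"
  by (rule hilbert_space_ell2) (rule K.hilbert_space_axioms)

abbreviation "T \<equiv> analysis_op I A"
abbreviation "Ts \<equiv> synthesis_op H K I A"
abbreviation "V \<equiv> range_space H K I A"
abbreviation "P \<equiv> proj H V"

lemmas spaces = H.hilbert_space_axioms K.hilbert_space_axioms E.hilbert_space_axioms

lemma member_ops: "i \<in> I \<Longrightarrow> A i \<in> bounded_ops H K UNIV UNIV"
  using bessel by (auto simp: bessel_def)

lemma summable: "(\<lambda>i. (norm (A i x))\<^sup>2) summable_on I"
  using bessel by (auto simp: bessel_def)

lemma analysis_nth: "ell2_nth (T x) i = (if i \<in> I then A i x else 0)"
proof -
  have "(\<lambda>i. (norm (if i \<in> I then A i x else 0))\<^sup>2) summable_on UNIV"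
    by (rule summable_on_cong_neutral[THEN iffD1, OF _ _ _ summable[of x]]) auto
  then show ?thesis by (simp add: analysis_op_def Abs_ell2_inverse)
qed

lemma analysis_mem: "T x \<in> ell2_on I"
  by (simp add: ell2_on_def analysis_nth)

lemma norm_analysis: "(norm (T x))\<^sup>2 = (\<Sum>\<^sub>\<infinity>i\<in>I. (norm (A i x))\<^sup>2)"
  using infsumI[OF has_sum_norm_ell2_on[OF analysis_mem[of x]], symmetric]
  by (auto simp: analysis_nth intro: infsum_cong)

lemma analysis_ops: "T \<in> bounded_ops H (ell2_space K) UNIV (ell2_on I)"
  unfolding bounded_ops_def
proof (intro CollectI conjI ballI allI)
  note eq = ell2_nth_inject[symmetric] fun_eq_iff K.ell2_smult_nth plus_ell2.rep_eq analysis_nth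
  show "T (x + y) = T x + T y" for x y
    using bounded_opsD(2)[OF member_ops] by (simp add: eq)
  show "T (smult H c x) = smult (ell2_space K) c (T x)" for c x
    using bounded_opsD(3)[OF member_ops] by (simp add: eq)
  obtain \<beta> where \<beta>: "\<beta> > 0" "\<And>x. (norm (T x))\<^sup>2 \<le> \<beta> * (norm x)\<^sup>2"
    using bessel by (auto simp: bessel_def norm_analysis)
  have "norm (T x) \<le> sqrt \<beta> * norm x" for x
    using real_le_rsqrt[OF \<beta>(2)[of x]] by (simp add: real_sqrt_mult)
  then show "\<exists>C. \<forall>x\<in>UNIV. norm (T x) \<le> C * norm x" by blast
qed (simp_all add: analysis_mem)

lemma analysis_ops': "T \<in> bounded_ops H (ell2_space K) UNIV UNIV"
  using analysis_ops by (rule bounded_ops_mono[rotated]) simp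

lemma bounded_linear_analysis: "bounded_linear T"
  using analysis_ops H.bounded_ops_UNIV_iff[OF spaces(3)] by blast

lemma synthesis_ops: "Ts \<in> bounded_ops (ell2_space K) H UNIV UNIV"
  unfolding synthesis_op_def by (rule H.adj_bounded_ops[OF spaces(3) analysis_ops'])

lemma inner_synthesis: "inner (T x) y = inner x (Ts y)"
  unfolding synthesis_op_def by (rule H.inner_adj[OF spaces(3) analysis_ops'])

lemma subspace_range_space: "H.vs.subspace V"
  unfolding range_space_def by (intro H.subspace_closure H.vs.subspace_span)

lemma closed_range_space: "closed V"
  unfolding range_space_def by simp

lemma adj_mem_range_space: "i \<in> I \<Longrightarrow> adj H K (A i) y \<in> V"
  unfolding range_space_def by (intro closure_subset[THEN subsetD] H.vs.span_base) blast

sublocale orthogonal_projection V P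
  by (rule H.proj_orthogonal_projection[OF subspace_range_space closed_range_space])

lemma P_ops: "P \<in> bounded_ops H H UNIV UNIV"
  unfolding H.bounded_ops_UNIV_iff[OF spaces(1)]
  by (simp add: bounded_linear H.proj_smult[OF subspace_range_space closed_range_space])

text \<open>If \<open>x\<close> is orthogonal to the range space, then
  \<open>(norm (A i x))\<^sup>2\<close> is the inner product of \<open>x\<close> with an element of
  the range of the adjoint of \<open>A i\<close>, hence 0. This is the kernel condition of
  \<open>closed_range_operator\<close>.\<close>

lemma analysis_eq_0: "P x = 0 \<Longrightarrow> T x = 0"
proof -
  assume "P x = 0"
  then have x: "inner x v = 0" if "v \<in> V" for v using orth[OF that, of x] by simp
  have "A i x = 0" if i: "i \<in> I" for i
  proof -
    have "inner (A i x) (A i x) = inner x (adj H K (A i) (A i x))"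
      by (rule H.inner_adj[OF spaces(2) member_ops[OF i]])
    also have "\<dots> = 0" by (rule x) (rule adj_mem_range_space[OF i])
    finally show ?thesis by simp
  qed
  then show "T x = 0" by (simp add: ell2_nth_inject[symmetric] fun_eq_iff analysis_nth zero_ell2.rep_eq)
qed

lemma subspace_ker_synthesis: "E.vs.subspace (ker_synthesis H K I A)"
proof -
  note S = subspace_ell2_on[OF spaces(2), of I]
  have "Ts 0 = 0" using bounded_opsD(3)[OF synthesis_ops, of 0 0] by simp
  then show ?thesis
    unfolding ker_synthesis_def
    by (intro E.vs.subspaceI) (auto simp: bounded_opsD[OF synthesis_ops] E.vs.subspace_0[OF S]
        E.vs.subspace_add[OF S] E.vs.subspace_scale[OF S])
qed

text \<open>Each finite partial sum is the image under \<open>Ts\<close> of a truncation of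
  \<open>y\<close>. The truncations converge to \<open>y\<close> in norm and \<open>Ts\<close> is
  continuous.\<close>

lemma has_sum_synthesis:
  assumes y: "y \<in> ell2_on I"
  shows "((\<lambda>i. adj H K (A i) (ell2_nth y i)) has_sum Ts y) I"
proof -
  define cut where "cut F = Abs_ell2 (\<lambda>i. if i \<in> F then ell2_nth y i else 0)" for F
  have cut: "ell2_nth (cut F) i = (if i \<in> F then ell2_nth y i else 0)" for F i
  proof -
    have "(\<lambda>i. (norm (if i \<in> F then ell2_nth y i else 0))\<^sup>2) summable_on UNIV"
      by (rule summable_on_comparison_test[OF ell2_nth_summable[of y]]) auto
    then show ?thesis by (simp add: cut_def Abs_ell2_inverse)
  qed
  have sum: "(\<Sum>i\<in>F. adj H K (A i) (ell2_nth y i)) = Ts (cut F)" if F: "finite F" "F \<subseteq> I" for F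
  proof (rule eq_if_inner_eq)
    fix x
    have "inner x (\<Sum>i\<in>F. adj H K (A i) (ell2_nth y i)) = (\<Sum>i\<in>F. inner (A i x) (ell2_nth y i))"
      unfolding inner_sum_right using F
      by (intro sum.cong refl) (auto simp: H.inner_adj[OF spaces(2) member_ops])
    also have "\<dots> = (\<Sum>\<^sub>\<infinity>i\<in>F. inner (A i x) (ell2_nth y i))" using F by simp
    also have "\<dots> = (\<Sum>\<^sub>\<infinity>i. inner (ell2_nth (T x) i) (ell2_nth (cut F) i))"
      using F by (intro infsum_cong_neutral) (auto simp: analysis_nth cut)
    also have "\<dots> = inner x (Ts (cut F))" by (simp add: inner_ell2_def flip: inner_synthesis)
    finally show "inner x (\<Sum>i\<in>F. adj H K (A i) (ell2_nth y i)) = inner x (Ts (cut F))" .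
  qed
  \<comment> \<open>Pythagoras: the squared error of the truncation is the tail of the series for
    \<open>(norm y)\<^sup>2\<close>.\<close>
  have norm: "(norm (cut F - y))\<^sup>2 = (norm y)\<^sup>2 - (\<Sum>i\<in>F. (norm (ell2_nth y i))\<^sup>2)" if "finite F" for F
  proof -
    have "inner (cut F) y = (\<Sum>\<^sub>\<infinity>i\<in>F. inner (ell2_nth y i) (ell2_nth y i))"
      "inner (cut F) (cut F) = (\<Sum>\<^sub>\<infinity>i\<in>F. inner (ell2_nth y i) (ell2_nth y i))"
      unfolding inner_ell2_def by (intro infsum_cong_neutral; auto simp: cut)+
    then show ?thesis
      using that by (simp add: power2_norm_eq_inner inner_diff_left inner_diff_right inner_commute)
  qed
  have "((\<lambda>F. (norm y)\<^sup>2 - (\<Sum>i\<in>F. (norm (ell2_nth y i))\<^sup>2)) \<longlongrightarrow> (norm y)\<^sup>2 - (norm y)\<^sup>2)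
      (finite_subsets_at_top I)"
    using has_sum_norm_ell2_on[OF y] unfolding has_sum_def by (intro tendsto_intros)
  then have "((\<lambda>F. (norm (cut F - y))\<^sup>2) \<longlongrightarrow> 0) (finite_subsets_at_top I)"
    unfolding diff_self
    by (rule Lim_transform_eventually) (auto simp: norm intro!: eventually_finite_subsets_at_top_weakI)
  from tendsto_real_sqrt[OF this] have "(cut \<longlongrightarrow> y) (finite_subsets_at_top I)"
    by (simp add: tendsto_norm_zero_iff LIM_zero_iff)
  moreover have "bounded_linear Ts"
    using synthesis_ops E.bounded_ops_UNIV_iff[OF spaces(1)] by blast
  ultimately have "((\<lambda>F. Ts (cut F)) \<longlongrightarrow> Ts y) (finite_subsets_at_top I)"
    by (simp add: bounded_linear.tendsto)
  then show ?thesis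
    unfolding has_sum_def
    by (rule Lim_transform_eventually) (auto simp: sum intro!: eventually_finite_subsets_at_top_weakI)
qed

end

section \<open>Frame sequences and their duals\<close>

text \<open>Here \<open>a\<close> bounds norms and not their squares, so it is the square root of a
  lower frame bound.\<close>

locale operator_frame_sequence = bessel_sequence +
  fixes a :: real
  assumes bound_pos: "0 < a" and lower_bound: "x \<in> V \<Longrightarrow> a * norm x \<le> norm (T x)"
begin

sublocale closed_range_operator V P T Ts a
proof (rule closed_range_operator.intro[OF orthogonal_projection_axioms],
    rule closed_range_operator_axioms.intro)
  show "closed V" "bounded_linear T" "0 < a"
    by (rule closed_range_space bounded_linear_analysis bound_pos)+
qed (rule inner_synthesis analysis_eq_0 lower_bound; assumption?)+

lemma frame_sequence: "\<exists>\<alpha> \<beta>. frame_sequence H K I A \<alpha> \<beta>"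
proof -
  obtain \<beta> where \<beta>: "\<beta> > 0" "\<And>x. (norm (T x))\<^sup>2 \<le> \<beta> * (norm x)\<^sup>2"
    using bessel by (auto simp: bessel_def norm_analysis)
  have "a\<^sup>2 * (norm x)\<^sup>2 \<le> (norm (T x))\<^sup>2" if "x \<in> V" for x
    using power_mono[OF lower_bound[OF that], of 2] bound_pos by (simp add: power_mult_distrib)
  then have "frame_sequence H K I A (a\<^sup>2) \<beta>"
    using \<beta> bound_pos by (auto simp: frame_sequence_def member_ops summable simp flip: norm_analysis)
  then show ?thesis by blast
qed

text \<open>The analysis operator of the dual with parameter \<open>L\<close>, written on the whole
  space; \<open>dual_seq\<close> consists of its coordinates.\<close>

definition dual_op :: "('b \<Rightarrow> 'c ell2) \<Rightarrow> 'b \<Rightarrow> 'c ell2" where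
  "dual_op L x = pinv_adj x + L (P x)"

lemma pinv_adj_ops: "pinv_adj \<in> bounded_ops H (ell2_space K) UNIV (ell2_on I)"
proof -
  have "pinv_adj (smult H c x) = smult (ell2_space K) c (pinv_adj x)" for c x
  proof -
    have "frame_inv (P (smult H c x)) = smult H c (frame_inv (P x))"
      by (rule frame_inv_eqI)
        (simp_all add: H.vs.subspace_scale[OF subspace_range_space] frame_frame_inv
          bounded_opsD(3)[OF analysis_ops] bounded_opsD(3)[OF synthesis_ops] bounded_opsD(3)[OF P_ops])
    then show ?thesis by (simp add: pinv_adj_def bounded_opsD(3)[OF analysis_ops])
  qed
  then show ?thesis
    unfolding H.bounded_ops_UNIV_iff[OF spaces(3)]
    by (simp add: bounded_linear_pinv_adj) (simp add: pinv_adj_def analysis_mem)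
qed

text \<open>The part \<open>pinv_adj (Ts y)\<close> lies in the range of \<open>T\<close>, which is
  orthogonal to the kernel of \<open>Ts\<close>, and the remainder lies in that kernel.\<close>

lemma proj_ker_synthesis:
  assumes "y \<in> ell2_on I"
  shows "proj (ell2_space K) (ker_synthesis H K I A) y = y - pinv_adj (Ts y)"
proof (rule E.proj_eqI[OF subspace_ker_synthesis])
  show "y - pinv_adj (Ts y) \<in> ker_synthesis H K I A"
    using assms bounded_opsD(1)[OF pinv_adj_ops]
    by (simp add: ker_synthesis_def adjoint_minus_range_projection
        E.vs.subspace_diff[OF subspace_ell2_on[OF spaces(2)]])
  show "inner (y - (y - pinv_adj (Ts y))) v = 0" if "v \<in> ker_synthesis H K I A" for v
    using that by (simp add: pinv_adj_def adjoint ker_synthesis_def)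
qed

context
  fixes L assumes L: "L \<in> dual_params H K I A"
begin

lemma dual_op_ops: "dual_op L \<in> bounded_ops H (ell2_space K) UNIV (ell2_on I)"
proof -
  have "(\<lambda>x. L (P x)) \<in> bounded_ops H (ell2_space K) UNIV (ell2_on I)"
    using L by (intro H.bounded_ops_proj subspace_range_space closed_range_space spaces)
      (auto simp: dual_params_def)
  then show ?thesis
    unfolding dual_op_def
    by (intro bounded_ops_add_diff(1) spaces subspace_ell2_on pinv_adj_ops)
qed

lemma dual_seq_eq: "dual_seq H K I A L = (\<lambda>i x. ell2_nth (dual_op L x) i)"
proof -
  have "frame_op H K I A = (\<lambda>x. Ts (T x))" by (simp add: frame_op_def fun_eq_iff)
  then show ?thesis
    by (intro ext) (simp add: dual_seq_def dual_op_def pinv_adj_def frame_inv_def Let_def)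
qed

lemma bessel_dual: "bessel H K I (dual_seq H K I A L)"
  and analysis_dual: "analysis_op I (dual_seq H K I A L) = dual_op L"
  unfolding dual_seq_eq using bessel_coordinates[OF spaces(1,2) dual_op_ops] by auto

lemma synthesis_dual_op: "Ts (dual_op L x) = P x"
  using L by (simp add: dual_op_def linear_add[OF adjoint_linear] adjoint_pinv_adj dual_params_def)

lemma dual_op_P: "dual_op L (P x) = dual_op L x"
  by (simp add: dual_op_def pinv_adj_P ident)

lemma norm_dual_op: "norm (dual_op L x) \<le> (1 / a + onorm_on V L) * norm x"
proof -
  have Lo: "L \<in> bounded_ops H (ell2_space K) V (ell2_on I)" using L by (simp add: dual_params_def)
  have "norm (L (P x)) \<le> onorm_on V L * norm (P x)" by (rule norm_le_onorm_on[OF Lo]) simp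
  also have "\<dots> \<le> onorm_on V L * norm x"
    using subspace_0[OF subspace] by (intro mult_left_mono norm_le onorm_on_nonneg[OF Lo])
  finally have "norm (L (P x)) \<le> onorm_on V L * norm x" .
  moreover have "norm (pinv_adj x) \<le> 1 / a * norm x"
    using norm_pinv_adj[of x] bound_pos by (simp add: field_simps)
  ultimately show ?thesis
    unfolding dual_op_def using norm_triangle_ineq[of "pinv_adj x" "L (P x)"]
    by (simp add: distrib_right)
qed

text \<open>The operator \<open>dual_op L\<close> vanishes on the complement of \<open>V\<close>, so
  the adjoints of the members map into \<open>V\<close>. The reproducing formula holds because the
  synthesis operator of the dual after \<open>T\<close> is the adjoint of \<open>Ts\<close> after
  \<open>dual_op L\<close>, that is, of \<open>P\<close>.\<close>

lemma is_dual_dual_seq: "is_dual H K I A (dual_seq H K I A L)"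
proof -
  interpret D: bessel_sequence H K I "dual_seq H K I A L"
    by (intro bessel_sequence.intro bessel_sequence_axioms.intro spaces bessel_dual)
  have dual0: "dual_op L x = 0" if "P x = 0" for x
    using dual_op_P[of x] that bounded_opsD(3)[OF dual_op_ops, of 0 0] by simp
  have mem: "adj H K (dual_seq H K I A L i) y \<in> V" if i: "i \<in> I" for i y
  proof (rule mem_if_orth_to_complement)
    fix x assume "P x = 0"
    then have "dual_seq H K I A L i x = 0" by (simp add: dual_seq_eq dual0 zero_ell2.rep_eq)
    then show "inner x (adj H K (dual_seq H K I A L i) y) = 0"
      using H.inner_adj[OF spaces(2) D.member_ops[OF i], of x y] by simp
  qed
  have "H.vs.span (\<Union>i\<in>I. range (adj H K (dual_seq H K I A L i))) \<subseteq> V"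
    by (rule H.vs.span_minimal[OF _ subspace_range_space]) (use mem in auto)
  then have "range_space H K I (dual_seq H K I A L) \<subseteq> V"
    unfolding range_space_def[of H K I "dual_seq H K I A L"]
    by (rule closure_minimal) (rule closed_range_space)
  moreover have "((\<lambda>i. adj H K (dual_seq H K I A L i) (A i x)) has_sum x) I" if x: "x \<in> V" for x
  proof -
    have "synthesis_op H K I (dual_seq H K I A L) (T x) = x"
    proof (rule eq_if_inner_eq)
      fix z
      have "inner z (synthesis_op H K I (dual_seq H K I A L) (T x)) = inner (dual_op L z) (T x)"
        by (simp add: analysis_dual flip: D.inner_synthesis)
      also have "\<dots> = inner (P z) x"
        by (metis adjoint inner_commute synthesis_dual_op)
      also have "\<dots> = inner z x" using x by (simp add: self_adjoint ident)
      finally show "inner z (synthesis_op H K I (dual_seq H K I A L) (T x)) = inner z x" .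
    qed
    then show ?thesis
      using has_sum_cong[THEN iffD1, OF _ D.has_sum_synthesis[OF analysis_mem[of x]],
          of "\<lambda>i. adj H K (dual_seq H K I A L i) (A i x)"] by (simp add: analysis_nth)
  qed
  ultimately show ?thesis using bessel_dual by (simp add: is_dual_def)
qed

end

end

section \<open>The gap of the range spaces and the perturbation of duals\<close>

lemma (in hilbert_space) directed_gap:
  assumes W: "vs.subspace W" "closed W"
  shows norm_le_directed_gap: "x \<in> V \<Longrightarrow> norm (x - proj H W x) \<le> directed_gap H V W * norm x"
    and directed_gap_nonneg: "0 \<in> V \<Longrightarrow> 0 \<le> directed_gap H V W"
proof -
  interpret P: orthogonal_projection W "proj H W" by (rule proj_orthogonal_projection[OF W])
  have "(\<lambda>x. x - proj H W x) \<in> bounded_ops H H UNIV UNIV"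
    unfolding bounded_ops_UNIV_iff[OF hilbert_space_axioms]
    by (simp add: bounded_linear_sub bounded_linear_ident P.bounded_linear proj_smult[OF W]
        vs.scale_right_diff_distrib)
  then have "(\<lambda>x. x - proj H W x) \<in> bounded_ops H H V UNIV" by (rule bounded_ops_restrict[rotated]) simp
  from onorm_on[OF this]
  show "x \<in> V \<Longrightarrow> norm (x - proj H W x) \<le> directed_gap H V W * norm x"
    "0 \<in> V \<Longrightarrow> 0 \<le> directed_gap H V W" by (auto simp: directed_gap_def)
qed

theorem theorem4p12:
  fixes H :: "('s::rc_field, 'h::{real_inner,complete_space}) hspace"
    and K :: "('s, 'k::{real_inner,complete_space}) hspace"
    and I :: "nat set"
    and A B :: "nat \<Rightarrow> 'h \<Rightarrow> 'k"
    and \<alpha> \<beta> \<mu> \<Delta> :: real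
  assumes "hilbert_space H" and "hilbert_space K"
    and "frame_sequence H K I A \<alpha> \<beta>"
    and "0 < \<mu>" and "\<mu> < sqrt \<alpha>"
    and "perturbation H K I \<mu> A B"
    and "\<Delta> = gap H (range_space H K I A) (range_space H K I B)" and "\<Delta> < 1"
  shows "(\<exists>\<alpha>' \<beta>'. frame_sequence H K I B \<alpha>' \<beta>') \<and>
    (\<forall>L\<in>dual_params H K I A.
      let M = (\<lambda>x. proj (ell2_space K) (ker_synthesis H K I B)
                     (analysis_op I (dual_seq H K I A L) x));
          lam = (\<mu> + (2 * sqrt \<alpha> - \<mu>) * \<Delta>) / (sqrt \<alpha> * (sqrt \<alpha> - \<mu>)) +
              (\<mu> / (sqrt \<alpha> - \<mu>) + \<Delta>) * onorm_on (range_space H K I A) L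
      in M \<in> dual_params H K I B \<and>
         is_dual H K I B (dual_seq H K I B M) \<and>
         perturbation H K I lam (dual_seq H K I A L) (dual_seq H K I B M))"
proof -
  define a where "a = sqrt \<alpha>"
  define V where "V = range_space H K I A"
  define W where "W = range_space H K I B"
  interpret H: hilbert_space H by fact
  interpret K: hilbert_space K by fact
  have pert: "bessel H K I A" "bessel H K I B"
      "onorm (\<lambda>x. analysis_op I A x - analysis_op I B x) \<le> \<mu>"
    using \<open>perturbation H K I \<mu> A B\<close> by (auto simp: perturbation_def)
  have \<alpha>: "\<alpha> > 0" and lower: "\<And>x. x \<in> V \<Longrightarrow> \<alpha> * (norm x)\<^sup>2 \<le> (\<Sum>\<^sub>\<infinity>i\<in>I. (norm (A i x))\<^sup>2)"
    using \<open>frame_sequence H K I A \<alpha> \<beta>\<close> by (auto simp: frame_sequence_def V_def)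
  have a: "a > 0" "a - \<mu> > 0" using \<alpha> \<open>\<mu> < sqrt \<alpha>\<close> by (auto simp: a_def)
  interpret BA: bessel_sequence H K I A
    by (intro bessel_sequence.intro bessel_sequence_axioms.intro assms(1,2) pert)
  interpret BB: bessel_sequence H K I B
    by (intro bessel_sequence.intro bessel_sequence_axioms.intro assms(1,2) pert)
  have lower_A: "a * norm x \<le> norm (BA.T x)" if "x \<in> V" for x
  proof -
    have "sqrt (\<alpha> * (norm x)\<^sup>2) \<le> sqrt ((norm (BA.T x))\<^sup>2)"
      using lower[OF that] unfolding BA.norm_analysis by (rule real_sqrt_le_mono)
    then show ?thesis by (simp add: real_sqrt_mult a_def)
  qed
  interpret A: operator_frame_sequence H K I A a
    by (intro operator_frame_sequence.intro BA.bessel_sequence_axioms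
        operator_frame_sequence_axioms.intro a lower_A) (simp add: V_def)
  have close: "norm (BA.T x - BB.T x) \<le> \<mu> * norm x" for x
    using onorm[OF bounded_linear_sub[OF BA.bounded_linear_analysis BB.bounded_linear_analysis], of x]
      mult_right_mono[OF pert(3) norm_ge_zero[of x]] by simp
  have gap: "norm (w - BA.P w) \<le> \<Delta> * norm w" if "w \<in> W" for w
  proof -
    have "norm (w - BA.P w) \<le> directed_gap H W V * norm w"
      unfolding V_def
      by (rule H.norm_le_directed_gap[OF BA.subspace_range_space BA.closed_range_space that])
    also have "\<dots> \<le> \<Delta> * norm w"
      by (rule mult_right_mono) (auto simp: assms(7) gap_def V_def W_def)
    finally show ?thesis .
  qed
  have gap': "norm (v - BB.P v) \<le> \<Delta> * norm v" if "v \<in> V" for v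
  proof -
    have "norm (v - BB.P v) \<le> directed_gap H V W * norm v"
      unfolding W_def
      by (rule H.norm_le_directed_gap[OF BB.subspace_range_space BB.closed_range_space that])
    also have "\<dots> \<le> \<Delta> * norm v"
      by (rule mult_right_mono) (auto simp: assms(7) gap_def V_def W_def)
    finally show ?thesis .
  qed
  have "0 \<in> V" unfolding V_def by (rule H.vs.subspace_0[OF BA.subspace_range_space])
  then have "0 \<le> directed_gap H V W"
    unfolding W_def by (rule H.directed_gap_nonneg[OF BB.subspace_range_space BB.closed_range_space])
  then have \<Delta>: "0 \<le> \<Delta>" by (simp add: assms(7) gap_def V_def W_def)
  interpret TB: bounded_linear BB.T by (rule BB.bounded_linear_analysis)
  interpret PB: bounded_linear BB.P by (rule BB.bounded_linear)
  have TB_P: "BB.T (BB.P x) = BB.T x" for x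
    using BB.analysis_eq_0[of "x - BB.P x"] by (simp add: PB.diff TB.diff BB.ident)
  \<comment> \<open>On the range space of \<open>A\<close> the triangle inequality gives the
    constant \<open>a - \<mu>\<close>; the gap condition carries it over to that of
    \<open>B\<close>.\<close>
  have lower_B: "(a - \<mu>) * norm y \<le> norm (BB.T y)" if "y \<in> W" for y
  proof (rule lower_bound_transfer[where U = BB.T, OF BA.orthogonal_projection_axioms
        BB.orthogonal_projection_axioms BB.closed_range_space TB_P])
    show "norm (w - BA.P w) \<le> \<Delta> * norm w" if "w \<in> BB.V" for w using gap that by (simp add: W_def)
    show "\<Delta> < 1" by fact
    show "(a - \<mu>) * norm x \<le> norm (BB.T x)" if "x \<in> BA.V" for x
      using lower_A[of x] that close[of x] norm_triangle_ineq2[of "BA.T x" "BB.T x"]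
      by (simp add: V_def left_diff_distrib)
    show "0 \<le> a - \<mu>" using a by simp
    show "y \<in> BB.V" using that by (simp add: W_def)
  qed
  interpret B: operator_frame_sequence H K I B "a - \<mu>"
    by (intro operator_frame_sequence.intro BB.bessel_sequence_axioms
        operator_frame_sequence_axioms.intro a lower_B) (simp add: W_def)
  have dual: "M \<in> dual_params H K I B \<and> is_dual H K I B (dual_seq H K I B M) \<and>
      perturbation H K I lam (dual_seq H K I A L) (dual_seq H K I B M)"
    if L: "L \<in> dual_params H K I A"
      and M_def: "M = (\<lambda>x. proj (ell2_space K) (ker_synthesis H K I B)
                     (analysis_op I (dual_seq H K I A L) x))"
      and lam: "lam = (\<mu> + (2 * a - \<mu>) * \<Delta>) / (a * (a - \<mu>)) +
              (\<mu> / (a - \<mu>) + \<Delta>) * onorm_on V L"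
    for L M lam
  proof -
    define F where "F = A.dual_op L"
    have F_ops: "F \<in> bounded_ops H (ell2_space K) UNIV (ell2_on I)"
      unfolding F_def by (rule A.dual_op_ops[OF L])
    have F_mem: "F x \<in> ell2_on I" for x using bounded_opsD(1)[OF F_ops] by simp
    have F_lin: "bounded_linear F" using F_ops H.bounded_ops_UNIV_iff[OF BA.spaces(3)] by blast
    have M: "M = (\<lambda>x. F x - B.pinv_adj (BB.Ts (F x)))"
      unfolding M_def A.analysis_dual[OF L] F_def[symmetric] by (simp add: B.proj_ker_synthesis[OF F_mem])
    have "(\<lambda>x. B.pinv_adj (BB.Ts (F x))) \<in> bounded_ops H (ell2_space K) UNIV (ell2_on I)"
      by (rule bounded_ops_compose[OF BA.spaces(1,1,3)
            bounded_ops_compose[OF BA.spaces(1,3,1) F_ops BB.synthesis_ops] B.pinv_adj_ops])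
    then have "M \<in> bounded_ops H (ell2_space K) UNIV (ell2_on I)"
      unfolding M by (rule bounded_ops_add_diff(2)[OF BA.spaces(1,3) subspace_ell2_on[OF assms(2)] F_ops])
    \<comment> \<open>\<open>M\<close> is defined on all of \<open>H\<close>; as a dual parameter it
      is restricted to the range space of \<open>B\<close>.\<close>
    then have M_dual: "M \<in> dual_params H K I B"
      by (auto simp: dual_params_def M B.adjoint_minus_range_projection
          intro: bounded_ops_restrict[OF subset_UNIV])
    define l where "l = onorm_on V L"
    have l: "0 \<le> l"
      unfolding l_def using L \<open>0 \<in> V\<close> by (intro onorm_on_nonneg) (auto simp: dual_params_def V_def)
    have f: "0 < 1 / a + l" using a l by (simp add: add_pos_nonneg)
    \<comment> \<open>The right-hand side is the constant of \<open>dual_perturbation_bound\<close>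
      for \<open>f = 1 / a + l\<close> and lower bound \<open>a - \<mu>\<close>.\<close>
    have lam': "lam = (1 / a + l) * \<Delta> + (\<Delta> + \<mu> * (1 / a + l)) / (a - \<mu>)"
    proof -
      \<comment> \<open>Writing \<open>\<mu>\<close> as \<open>a - b\<close> turns the denominators
        into products of the positive variables \<open>a\<close> and \<open>b\<close>.\<close>
      define b where "b = a - \<mu>"
      then have b: "b > 0" "\<mu> = a - b" using a by auto
      have "2 * a - (a - b) = a + b" "a - (a - b) = b" by simp_all
      then show ?thesis unfolding lam l_def[symmetric] b(2) using a(1) b(1) by (simp add: field_simps)
    qed
    \<comment> \<open>A perturbation constant has to be positive; \<open>\<mu>\<close> provides this
      even when the gap is 0.\<close>
    have "0 < (\<Delta> + \<mu> * (1 / a + l)) / (a - \<mu>)"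
      using f \<Delta> a(2) \<open>0 < \<mu>\<close> by (intro divide_pos_pos) (auto intro: add_nonneg_pos mult_pos_pos)
    moreover have "0 \<le> (1 / a + l) * \<Delta>" using f \<Delta> by simp
    ultimately have lam_pos: "0 < lam" unfolding lam' by linarith
    have "onorm (\<lambda>x. F x - B.dual_op M x) \<le> lam"
    proof (rule onorm_bound)
      fix x
      show "norm (F x - B.dual_op M x) \<le> lam * norm x"
        unfolding lam' B.dual_op_def M
      \<comment> \<open>The locale operator is that of \<open>B\<close>, so the range space and
        projection of \<open>A\<close> take the places of \<open>W\<close> and
        \<open>Q\<close>.\<close>
      proof (rule B.dual_perturbation_bound[OF BA.orthogonal_projection_axioms])
        show "linear F" using F_lin by (rule bounded_linear.linear)
        show "F (BA.P x) = F x" for x unfolding F_def by (rule A.dual_op_P[OF L])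
        show "norm (F x) \<le> (1 / a + l) * norm x" for x
          unfolding F_def l_def V_def by (rule A.norm_dual_op[OF L])
        show "BA.Ts (F x) = BA.P x" for x unfolding F_def by (rule A.synthesis_dual_op[OF L])
        show "norm (BA.T x - BB.T x) \<le> \<mu> * norm x" for x by (rule close)
      qed (use f \<Delta> \<open>0 < \<mu>\<close> gap gap' in \<open>auto simp: BA.inner_synthesis V_def W_def\<close>)
    qed (use lam_pos in simp)
    with lam_pos have "perturbation H K I lam (dual_seq H K I A L) (dual_seq H K I B M)"
      unfolding perturbation_def A.analysis_dual[OF L] B.analysis_dual[OF M_dual] F_def
      using A.bessel_dual[OF L] B.bessel_dual[OF M_dual] by simp
    with M_dual B.is_dual_dual_seq[OF M_dual] show ?thesis by blast
  qed
  show ?thesis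
    unfolding Let_def
    by (intro conjI[OF B.frame_sequence] ballI dual) (auto simp: a_def V_def)
qed

end
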